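(* Under the assumption that $\log \#T = O(1)$ for every considered tree $T$, the algorithm PrimesAHU described below decides whether $T_1\simeq T_2$ in time $O(n)$, where $n=\#T_1=\#T_2$.
   Context: Trees are unordered rooted trees. $\mathrm{children}(u)$ denotes the set of children of node $u$; $\deg(u)=\#\mathrm{children}(u)$ and $\deg(T)=\max_{u\in T}\deg(u)$. The depth of a node is the length of the path from the root to it, and the depth $\mathrm{depth}(T)$ of $T$ is the maximal depth of its nodes. The level of a node $u$ is $\mathrm{depth}(T)-(\text{depth of }u)$, and $T^d$ is the set of nodes of level $d$. Two trees are isomorphic ($T_1\simeq T_2$) if there is a bijection between their nodes mapping roots to roots and preserving the child relation. Algorithm PrimesAHU on input $(T_1,T_2)$: if $\mathrm{depth}(T_1)\neq\mathrm{depth}(T_2)$, return false. Otherwise, for $d$ from $0$ to $\mathrm{depth}(T_1)$: start a fresh map $f$ with $f(1)=2$ and current prime $p=2$; for each $i\in\{1,2\}$ and each $u\in T_i^d$, compute $N(u)=\prod_{v\in\mathrm{children}(u)} c(v)$ (the empty product being $1$); if $f(N(u))$ is undefined, let $p$ be the next prime after the current one (primes are taken in increasing order and, when needed, new primes are generated by a segmented sieve of Eratosthenes) and set $f(N(u))=p$; then set $c(u)=f(N(u))$. After processing level $d$, if the multiset $\{\!\{c(u):u\in T_1^d\}\!\}$ differs from $\{\!\{c(u):u\in T_2^d\}\!\}$, return false. At the end return true. Complexity model: membership/lookup in $f$ (integer keys) is $O(1)$ by perfect hashing of integers (Fredman–Komlós–Szemerédi), the multiset comparison at level $d$ is done by pigeonhole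 sort in $O(\#T^d)$, products of lists are computed by divide and conquer, and multiplying two $m$-bit integers costs $M(m)=m\log m\log\log m$ (Schönhage–Strassen). *)

theory Defs
  imports
    "HOL-Library.Multiset"
    "HOL-Library.Log_Nat"
    "HOL-Library.Monad_Syntax"
    "HOL-Library.While_Combinator"
    "HOL-Computational_Algebra.Primes"
begin

section \<open>Unordered rooted trees\<close>

text \<open>The pair \<open>(u, v)\<close> is in \<open>child T\<close> if \<open>v\<close> is a child of \<open>u\<close>.\<close>

record 'a rtree =
  nodes :: "'a set"
  root :: 'a
  child :: "('a \<times> 'a) set"

definition rooted_tree :: "'a rtree \<Rightarrow> bool" where
  "rooted_tree T \<longleftrightarrow>
     finite (nodes T) \<and> root T \<in> nodes T \<and>
     child T \<subseteq> nodes T \<times> nodes T \<and>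
     (\<forall>u. (u, root T) \<notin> child T) \<and>
     (\<forall>v \<in> nodes T - {root T}. \<exists>!u. (u, v) \<in> child T) \<and>
     (\<forall>v \<in> nodes T. (root T, v) \<in> (child T)\<^sup>*)"

definition children :: "'a rtree \<Rightarrow> 'a \<Rightarrow> 'a set" where
  "children T u = {v. (u, v) \<in> child T}"

definition node_depth :: "'a rtree \<Rightarrow> 'a \<Rightarrow> nat" where
  "node_depth T u = (THE k. (root T, u) \<in> child T ^^ k)"

definition tree_depth :: "'a rtree \<Rightarrow> nat" where
  "tree_depth T = Max (node_depth T ` nodes T)"

definition node_level :: "'a rtree \<Rightarrow> 'a \<Rightarrow> nat" where
  "node_level T u = tree_depth T - node_depth T u"

definition level_set :: "'a rtree \<Rightarrow> nat \<Rightarrow> 'a set" where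
  "level_set T d = {u \<in> nodes T. node_level T u = d}"

definition tree_iso :: "'a rtree \<Rightarrow> 'b rtree \<Rightarrow> bool" (infix "\<simeq>" 50) where
  "T1 \<simeq> T2 \<longleftrightarrow>
     (\<exists>\<phi>. bij_betw \<phi> (nodes T1) (nodes T2) \<and> \<phi> (root T1) = root T2 \<and>
        (\<forall>u \<in> nodes T1. \<forall>v \<in> nodes T1.
           (u, v) \<in> child T1 \<longleftrightarrow> (\<phi> u, \<phi> v) \<in> child T2))"

text \<open>
  A layout fixes the orders in which the algorithm runs through the children of a node and
  through the nodes of a level. These orders are arbitrary.
\<close>

record 'a layout =
  child_list :: "'a \<Rightarrow> 'a list"
  level_list :: "nat \<Rightarrow> 'a list"

definition layout_of :: "'a layout \<Rightarrow> 'a rtree \<Rightarrow> bool" where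
  "layout_of L T \<longleftrightarrow>
     (\<forall>u \<in> nodes T. distinct (child_list L u) \<and> set (child_list L u) = children T u) \<and>
     (\<forall>d. distinct (level_list L d) \<and> set (level_list L d) = level_set T d)"


section \<open>Computations with a running time\<close>

text \<open>
  Running times are fixed up to a constant factor: every operation in \<open>O(1)\<close> is charged one
  unit, and multiplication has the real-valued cost given below.
\<close>

datatype 'a timed = Timed (result: 'a) (time: real)

definition return :: "'a \<Rightarrow> 'a timed" where
  "return x = Timed x 0"

definition tick :: "real \<Rightarrow> unit timed" where
  "tick t = Timed () t"

definition bind_timed :: "'a timed \<Rightarrow> ('a \<Rightarrow> 'b timed) \<Rightarrow> 'b timed" where
  "bind_timed m g =
     Timed (result (g (result m))) (time m + time (g (result m)))"

adhoc_overloading Monad_Syntax.bind \<rightleftharpoons> bind_timed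

fun fold_timed :: "('a \<Rightarrow> 's \<Rightarrow> 's timed) \<Rightarrow> 'a list \<Rightarrow> 's \<Rightarrow> 's timed" where
  "fold_timed g [] s = return s"
| "fold_timed g (x # xs) s = do { s' \<leftarrow> g x s; fold_timed g xs s' }"


section \<open>Multiplication\<close>

text \<open>
  The Schoenhage--Strassen cost \<open>m log m log log m\<close>. The logarithmic factors are bounded below
  by 1, since they vanish, are negative or are undefined for very small \<open>m\<close>.
\<close>

definition mult_cost :: "nat \<Rightarrow> real" where
  "mult_cost m = real m * max 1 (log 2 (real m)) * max 1 (log 2 (log 2 (real m)))"

text \<open>For positive \<open>x\<close>, \<open>floorlog 2 x\<close> is the number of binary digits of \<open>x\<close>.\<close>

definition mult_timed :: "nat \<Rightarrow> nat \<Rightarrow> nat timed" where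
  "mult_timed x y =
     do { tick (1 + mult_cost (max (floorlog 2 x) (floorlog 2 y))); return (x * y) }"

fun product :: "nat list \<Rightarrow> nat timed" where
  "product [] = do { tick 1; return 1 }"
| "product [x] = do { tick 1; return x }"
| "product (x # y # zs) =
     (let xs = x # y # zs; h = length xs div 2
      in do { a \<leftarrow> product (take h xs); b \<leftarrow> product (drop h xs); mult_timed a b })"


section \<open>Segmented sieve of Eratosthenes\<close>

text \<open>
  \<open>primes S\<close> lists the primes up to \<open>bound S\<close> in increasing order. The segment that follows
  \<open>bound S = m\<close> consists of \<open>m + 1, \<dots>, 2 m\<close>; it is sieved by the known primes \<open>q\<close> with
  \<open>q\<^sup>2 \<le> 2 m\<close>. The cost counts the cells of the segment, the sieving primes and the crossings-out.
\<close>

record sieve =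
  bound :: nat
  primes :: "nat list"

definition cross_out :: "nat \<Rightarrow> nat \<Rightarrow> nat list \<Rightarrow> nat list timed" where
  "cross_out m q xs =
     do { tick (1 + real (card {x \<in> {m<..2 * m}. q dvd x}));
          return (filter (\<lambda>x. \<not> q dvd x) xs) }"

definition sieve_segment :: "sieve \<Rightarrow> sieve timed" where
  "sieve_segment S =
     (let m = bound S
      in do { tick (1 + real m);
              xs \<leftarrow> fold_timed (cross_out m)
                     (takeWhile (\<lambda>q. q * q \<le> 2 * m) (primes S)) [m + 1..<2 * m + 1];
              return \<lparr>bound = 2 * m, primes = primes S @ xs\<rparr> })"

text \<open>Sieve further segments until the prime with index \<open>k\<close> (counted from 0) is known.\<close>

definition ensure_prime :: "nat \<Rightarrow> sieve \<Rightarrow> sieve timed" where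
  "ensure_prime k S =
     while (\<lambda>s. length (primes (result s)) \<le> k) (\<lambda>s. s \<bind> sieve_segment)
       (do { tick 1; return S })"

definition initial_sieve :: sieve where
  "initial_sieve = \<lparr>bound = 2, primes = [2]\<rparr>"


section \<open>The algorithm PrimesAHU\<close>

text \<open>
  The state consists of the values \<open>c\<close> found so far, the map \<open>f\<close>, the index \<open>k\<close> of the current
  prime, and the sieve. The map and the current prime are reset at each level, whereas the
  sieve is kept.
\<close>

definition process_node ::
  "('a \<Rightarrow> 'a list) \<Rightarrow> 'a \<Rightarrow> ('a \<Rightarrow> nat) \<times> (nat \<rightharpoonup> nat) \<times> nat \<times> sieve \<Rightarrow>
     (('a \<Rightarrow> nat) \<times> (nat \<rightharpoonup> nat) \<times> nat \<times> sieve) timed" where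
  "process_node kids u = (\<lambda>(c, f, k, S).
     do { N \<leftarrow> product (map c (kids u));
          tick 1;
          case f N of
            Some p \<Rightarrow> return (c(u := p), f, k, S)
          | None \<Rightarrow>
              do { S' \<leftarrow> ensure_prime (k + 1) S;
                   let p = primes S' ! (k + 1);
                   tick 1;
                   return (c(u := p), f(N \<mapsto> p), k + 1, S') } })"

fun process_levels ::
  "'a layout \<Rightarrow> 'b layout \<Rightarrow> nat list \<Rightarrow> ('a \<Rightarrow> nat) \<Rightarrow> ('b \<Rightarrow> nat) \<Rightarrow> sieve \<Rightarrow> bool timed"
where
  "process_levels L1 L2 [] c1 c2 S = return True"
| "process_levels L1 L2 (d # ds) c1 c2 S =
     do { (c1', f1, k1, S1) \<leftarrow>
            fold_timed (process_node (child_list L1)) (level_list L1 d) (c1, [1 \<mapsto> 2], 0, S);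
          (c2', f2, k2, S2) \<leftarrow>
            fold_timed (process_node (child_list L2)) (level_list L2 d) (c2, f1, k1, S1);
          tick (1 + real (length (level_list L1 d)) + real (length (level_list L2 d)));
          if image_mset c1' (mset (level_list L1 d)) \<noteq> image_mset c2' (mset (level_list L2 d))
          then return False
          else process_levels L1 L2 ds c1' c2' S2 }"

text \<open>
  The first charge pays for the traversals that compute the depths and the level lists. The
  initial values of \<open>c\<close> are never read.
\<close>

definition primes_ahu ::
  "'a rtree \<Rightarrow> 'a layout \<Rightarrow> 'b rtree \<Rightarrow> 'b layout \<Rightarrow> bool timed" where
  "primes_ahu T1 L1 T2 L2 =
     do { tick (real (card (nodes T1)) + real (card (nodes T2)));
          if tree_depth T1 \<noteq> tree_depth T2 then return False
          else process_levels L1 L2 [0..<tree_depth T1 + 1] (\<lambda>_. 0) (\<lambda>_. 0) initial_sieve }"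

end

theory Submission
  imports Defs
begin

text \<open>
  The shape of a node is its subtree up to isomorphism, written as a nested multiset. By unique
  factorization, the product of the colours of the children determines the multiset of these
  colours; hence, level by level, the colours of the nodes of both trees are the values of one
  injective prime-valued function of the shapes. So the comparisons at all levels succeed for
  isomorphic trees, and the one at the top level compares the shapes of the roots.

  For the running time, let \<open>n \<le> 2 ^ D\<close>. At most \<open>2 n\<close> primes are requested at a level, so
  by Chebyshev's lower bound for the number of primes the sieve stays below \<open>O(D n)\<close>. Its total
  cost is bounded by the potential \<open>m (log m + 4)\<close> of its bound \<open>m\<close>. All colours have \<open>O(D)\<close>
  bits, so the divide and conquer products cost polylogarithmically many steps per child, and the
  numbers of children add up to less than \<open>n\<close>.
\<close>

section \<open>Chebyshev's lower bound for the number of primes\<close>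

text \<open>For a fixed bound on log #T only finitely many tree sizes occur, so even exhaustive
  search would count as linear, with a constant that explodes with the bound. The running time is
  therefore stated as \<open>c * B ^ e * n\<close> with \<open>c\<close> and \<open>e\<close> chosen
  before the bound \<open>B\<close>; the proof yields \<open>e = 4\<close>.

  Two features of the algorithm shape the argument. The map is reset at each level, so colours of
  different levels are unrelated: the invariant claims an injective colouring of one level at a
  time, which suffices because all children of a node lie exactly one level below it. The sieve
  survives all levels, so its cost is amortised over the whole run instead of being charged to each
  level.

  A node may have almost n children, and the product of their colours then has up to O(D n) bits. A
  single multiplication is thus not polylogarithmic; only the cost per child is.\<close>

text \<open>
  Among the reciprocals \<open>1 / ((n + 1) (n choose k))\<close>, which form the Leibniz triangle, each one is
  a difference of two in the previous column, and those of the first column are \<open>1 / (n + 1)\<close>.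
  Hence \<open>Lcm {1..N}\<close> is a multiple of all their denominators.
\<close>

lemma leibniz_triangle:
  assumes "k \<le> n"
  shows "1 / (real (Suc (Suc n)) * real (Suc n choose Suc k)) =
         1 / (real (Suc n) * real (n choose k)) - 1 / (real (Suc (Suc n)) * real (Suc n choose k))"
proof -
  define a where "a = real (n choose k)"
  have a: "a > 0"
    using assms by (simp add: a_def zero_less_binomial)
  \<comment> \<open>The absorption identities express both entries of row \<open>Suc n\<close>
    through \<open>a\<close>; what remains is a rational identity in \<open>n\<close> and
    \<open>k\<close>.\<close>
  have "real (Suc k) * real (Suc n choose Suc k) = real (Suc n) * a"
    unfolding a_def of_nat_mult [symmetric] by (simp only: Suc_times_binomial_eq mult.commute)
  then have 1: "real (Suc n choose Suc k) = real (Suc n) * a / real (Suc k)"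
    by (simp add: field_simps)
  have "(Suc n - k) * (Suc n choose k) = Suc n * (n choose k)"
    using binomial_absorb_comp [of "Suc n" k] by simp
  then have "real (Suc n - k) * real (Suc n choose k) = real (Suc n) * a"
    unfolding a_def of_nat_mult [symmetric] by presburger
  then have 2: "real (Suc n choose k) = real (Suc n) * a / real (Suc n - k)"
    using assms by (simp add: field_simps)
  have 3: "real (Suc n - k) = real n + 1 - real k"
    using assms by simp
  show ?thesis
    unfolding 1 2 a_def [symmetric] using a assms 3 by (simp add: divide_simps)
qed

lemma Suc_times_binomial_dvd_Lcm:
  assumes "k \<le> n" "n < N"
  shows "Suc n * (n choose k) dvd Lcm {1..N}"
proof -
  define M where "M = Lcm {1..N}"
  \<comment> \<open>Integrality of a quotient replaces divisibility because the recursion subtracts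
    reciprocals. Both terms of the difference lie in column \<open>k\<close>, in rows below
    \<open>N\<close>, so \<open>n\<close> is generalised.\<close>
  have "real M / (real (Suc n) * real (n choose k)) \<in> \<int>"
    using assms
  proof (induction k arbitrary: n)
    case 0
    then have "Suc n dvd M"
      unfolding M_def by (intro dvd_Lcm) auto
    then obtain q where q: "M = Suc n * q"
      by (elim dvdE)
    then have "real M / (real (Suc n) * real (n choose 0)) = real q"
      by (simp only: q of_nat_mult binomial_n_0) (simp del: of_nat_Suc)
    then show ?case
      by simp
  next
    case (Suc k n')
    then obtain n where n: "n' = Suc n" "k \<le> n"
      by (cases n') auto
    have "real M / (real (Suc (Suc n)) * real (Suc n choose Suc k)) =
            real M / (real (Suc n) * real (n choose k)) - real M / (real (Suc (Suc n)) * real (Suc n choose k))"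
      using arg_cong [OF leibniz_triangle [OF n(2)], of "\<lambda>x. real M * x"]
      by (simp only: right_diff_distrib times_divide_eq_right mult_1_right)
    also have "\<dots> \<in> \<int>"
      using Suc n by (intro Ints_diff Suc.IH) auto
    finally show ?case
      by (simp only: n)
  qed
  then obtain z where "real M / (real (Suc n) * real (n choose k)) = of_int z"
    by (elim Ints_cases)
  then have z: "real M / real (Suc n * (n choose k)) = of_int z"
    by (simp only: of_nat_mult)
  have "real (Suc n * (n choose k)) > 0"
    unfolding of_nat_0_less_iff using assms by (simp add: zero_less_binomial)
  with z have "real M = of_int z * real (Suc n * (n choose k))"
    by (simp only: divide_eq_eq)
  then have "real_of_int (int M) = of_int (z * int (Suc n * (n choose k)))"
    by (simp only: of_int_mult of_int_of_nat_eq)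
  then have "int M = z * int (Suc n * (n choose k))"
    by (simp only: of_int_eq_iff)
  then have "int (Suc n * (n choose k)) dvd int M"
    by simp
  then show ?thesis
    by (simp only: M_def int_dvd_int_iff)
qed

text \<open>Every prime power dividing some i <= N is itself at most N. So the lcm divides the
  product, over the primes p <= N, of the largest powers of p not exceeding N, and each of these
  factors is at most N.\<close>

lemma Lcm_le_power_card_primes: "Lcm {1..N} \<le> N ^ card {p. prime p \<and> p \<le> N}" for N :: nat
proof (cases "N = 0")
  case False
  define P where "P = {p. prime p \<and> p \<le> N}"
  define e where "e p = (GREATEST k. p ^ k \<le> N)" for p
  have fin: "finite P"
    by (auto simp: P_def)
  \<comment> \<open>Bounds the exponents, so that the \<open>GREATEST\<close> in \<open>e\<close> is
    attained.\<close>
  have ex: "k \<le> N" if "p ^ k \<le> N" "prime p" for p k :: nat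
  proof -
    have "k < 2 ^ k" by simp
    also have "(2::nat) ^ k \<le> p ^ k"
      using that(2) prime_ge_2_nat by (intro power_mono) auto
    finally show ?thesis using that by simp
  qed
  have e_le: "p ^ e p \<le> N" if "prime p" for p
    unfolding e_def by (rule GreatestI_nat [of _ 0 N]) (use False ex that in auto)
  have e_ge: "k \<le> e p" if "prime p" "p ^ k \<le> N" for p k
    unfolding e_def by (rule Greatest_le_nat [of _ _ N]) (use that ex in auto)
  define Q where "Q = (\<Prod>p\<in>P. p ^ e p)"
  have Q0: "Q > 0"
    unfolding Q_def by (intro prod_pos) (auto simp: P_def prime_gt_0_nat)
  have "i dvd Q" if "i \<in> {1..N}" for i
  proof (rule multiplicity_le_imp_dvd)
    fix p :: nat assume p: "prime p"
    show "multiplicity p i \<le> multiplicity p Q"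
    proof (cases "multiplicity p i = 0")
      case False
      have "p ^ multiplicity p i \<le> i"
        using that by (intro dvd_imp_le multiplicity_dvd) auto
      then have le: "p ^ multiplicity p i \<le> N"
        using that by auto
      moreover have "p \<le> p ^ multiplicity p i"
        using False p prime_gt_0_nat self_le_power[of p] by (metis One_nat_def Suc_leI neq0_conv)
      ultimately have "p \<in> P"
        using p by (auto simp: P_def)
      then have "p ^ e p dvd Q"
        unfolding Q_def using fin by (intro dvd_prodI) auto
      then have "p ^ multiplicity p i dvd Q"
        using e_ge [OF p le] by (meson dvd_trans le_imp_power_dvd)
      then show ?thesis
        using p Q0 by (intro multiplicity_geI) (auto simp: not_prime_unit)
    qed auto
  qed (use that in auto)
  then have "Lcm {1..N} dvd Q"
    by (intro Lcm_least) auto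
  then have "Lcm {1..N} \<le> Q"
    using Q0 by (intro dvd_imp_le) auto
  also have "Q \<le> (\<Prod>p\<in>P. N)"
    unfolding Q_def by (intro prod_mono) (auto simp: P_def e_le)
  finally show ?thesis
    by (simp add: P_def)
next
  case True
  then have "{p. prime p \<and> p \<le> N} = {}"
    by auto
  with True show ?thesis
    by (simp only: card.empty) simp
qed

text \<open>Nair's argument: the factor 2m+1 of the Leibniz denominator outweighs the 2m lost in the
  bound 4^m / (2m) for the central binomial coefficient, so no correction factor is left.\<close>

lemma power_4_le_power_card_primes: "4 ^ m \<le> (2 * m + 1) ^ card {p::nat. prime p \<and> p \<le> 2 * m + 1}"
proof (cases "m = 0")
  case False
  have "4 ^ m / (2 * real m) \<le> real ((2 * m) choose m)"
    using False by (intro central_binomial_lower_bound) auto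
  then have "4 ^ m \<le> real ((2 * m) choose m) * (2 * real m)"
    using False by (simp add: field_simps)
  also have "\<dots> \<le> real (Suc (2 * m) * ((2 * m) choose m))"
    by (simp add: algebra_simps)
  finally have "real (4 ^ m) \<le> real (Suc (2 * m) * ((2 * m) choose m))"
    by simp
  then have "4 ^ m \<le> Suc (2 * m) * ((2 * m) choose m)"
    by (simp only: of_nat_le_iff)
  also have "\<dots> \<le> Lcm {1..2 * m + 1}"
  proof (rule dvd_imp_le)
    show "Suc (2 * m) * (2 * m choose m) dvd Lcm {1..2 * m + 1}"
      by (rule Suc_times_binomial_dvd_Lcm) auto
    show "0 < Lcm {1..2 * m + 1}"
      using Lcm_0_iff_nat by (metis atLeastAtMost_iff finite_atLeastAtMost gr0I not_one_le_zero)
  qed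
  also have "\<dots> \<le> (2 * m + 1) ^ card {p::nat. prime p \<and> p \<le> 2 * m + 1}"
    by (rule Lcm_le_power_card_primes)
  finally show ?thesis .
qed auto

section \<open>Counting primes up to powers of two\<close>

definition primes_upto :: "nat \<Rightarrow> nat list" where
  "primes_upto m = filter prime [0..<Suc m]"

lemma set_primes_upto: "set (primes_upto m) = {p. prime p \<and> p \<le> m}"
  by (auto simp: primes_upto_def le_less)

lemma distinct_primes_upto [simp]: "distinct (primes_upto m)"
  by (simp add: primes_upto_def)

lemma length_primes_upto: "length (primes_upto m) = card {p. prime p \<and> p \<le> m}"
  using distinct_card [OF distinct_primes_upto] by (simp add: set_primes_upto)

lemma primes_upto_append: "m \<le> m' \<Longrightarrow> primes_upto m' = primes_upto m @ filter prime [Suc m..<Suc m']"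
  unfolding primes_upto_def filter_append [symmetric]
  by (metis Suc_le_mono le_add_diff_inverse upt_add_eq_append zero_le)

lemma chebyshev_power_2:
  assumes "j \<ge> 1"
  shows "2 ^ j \<le> j * length (primes_upto (2 ^ j)) + 2"
proof -
  \<comment> \<open>With this choice 2m+1 = 2^j - 1 lies just below 2^j. Comparing exponents of 2
    then gives 2m on the left, and the \<open>+ 2\<close> of the claim is 2^j - 2m.\<close>
  define m where "m = (2::nat) ^ (j - 1) - 1"
  have j: "(2::nat) ^ j = 2 * m + 2"
  proof (cases j)
    case (Suc i)
    have "(2::nat) ^ i \<ge> 1" by simp
    then have "2 * ((2::nat) ^ i - 1) + 2 = 2 * 2 ^ i" by linarith
    then show ?thesis by (simp add: m_def Suc)
  qed (use assms in auto)
  have "(2::nat) ^ (2 * m) = 4 ^ m"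
    by (simp add: power_mult)
  also have "\<dots> \<le> (2 * m + 1) ^ card {p::nat. prime p \<and> p \<le> 2 * m + 1}"
    by (rule power_4_le_power_card_primes)
  also have "\<dots> \<le> (2 * m + 1) ^ card {p::nat. prime p \<and> p \<le> 2 ^ j}"
    unfolding j by (intro power_increasing card_mono) auto
  also have "\<dots> \<le> (2 ^ j) ^ length (primes_upto (2 ^ j))"
    unfolding j length_primes_upto by (intro power_mono) auto
  also have "\<dots> = 2 ^ (j * length (primes_upto (2 ^ j)))"
    by (simp add: power_mult)
  finally have "2 * m \<le> j * length (primes_upto (2 ^ j))"
    by simp
  then show ?thesis
    using j by simp
qed

lemma square_le_4_power_2: "j ^ 2 \<le> 4 * 2 ^ j" for j :: nat
proof (induction j)
  case (Suc j)
  show ?case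
  proof (cases "j \<le> 3")
    case True
    then have "j = 0 \<or> j = 1 \<or> j = 2 \<or> j = 3" by auto
    then show ?thesis by (elim disjE) (simp_all add: power2_eq_square)
  next
    case False
    then have "2 * j + 1 \<le> j * j"
      using mult_le_mono1[of 4 j j] by linarith
    with Suc show ?thesis
      by (simp add: power2_eq_square)
  qed
qed auto

text \<open>Inverts Chebyshev's bound. The first form yields the running time. The second is cruder
  but its right-hand side is free of \<open>j\<close>; it yields the termination measure of
  \<open>ensure_prime\<close> and a first bound on the exponent \<open>j\<close>.\<close>

lemma few_primes_upto_power_2:
  assumes "j \<ge> 1" "length (primes_upto (2 ^ j)) \<le> k"
  shows "2 ^ j \<le> j * (k + 2)" "2 ^ j \<le> 4 * (k + 2) ^ 2"
proof -
  have "2 ^ j \<le> j * length (primes_upto (2 ^ j)) + 2"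
    by (rule chebyshev_power_2) fact
  also have "\<dots> \<le> j * k + j * 2"
    using assms by (intro add_mono mult_mono) auto
  finally show 1: "2 ^ j \<le> j * (k + 2)"
    by (simp add: algebra_simps)
  \<comment> \<open>Bootstrapping: j^2 is O(2^j), hence O(j (k + 2)), and cancelling one
    \<open>j\<close> bounds \<open>j\<close> by a multiple of \<open>k + 2\<close>.\<close>
  have "j * j \<le> 4 * 2 ^ j"
    using square_le_4_power_2 [of j] by (simp add: power2_eq_square)
  also have "\<dots> \<le> 4 * (j * (k + 2))"
    using 1 by (intro mult_le_mono2)
  also have "\<dots> = j * (4 * (k + 2))"
    by (simp only: mult.left_commute)
  finally have "j \<le> 4 * (k + 2)"
    using assms by simp
  then have "j * (k + 2) \<le> 4 * (k + 2) * (k + 2)"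
    by (rule mult_le_mono1)
  with 1 show "2 ^ j \<le> 4 * (k + 2) ^ 2"
    by (simp add: power2_eq_square algebra_simps)
qed


section \<open>The sieve\<close>

lemma result_bind [simp]: "result (bind_timed m g) = result (g (result m))"
  by (simp add: bind_timed_def)

lemma time_bind [simp]: "time (bind_timed m g) = time m + time (g (result m))"
  by (simp add: bind_timed_def)

lemma result_return [simp]: "result (return x) = x"
  and time_return [simp]: "time (return x) = 0"
  by (simp_all add: return_def)

lemma time_tick [simp]: "time (tick t) = t"
  by (simp add: tick_def)

section \<open>Correctness and cost of one segment\<close>

lemma result_fold_cross_out:
  "result (fold_timed (cross_out m) qs xs) = filter (\<lambda>x. \<forall>q\<in>set qs. \<not> q dvd x) xs"
  by (induction qs arbitrary: xs) (auto simp: cross_out_def intro: filter_cong)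

lemma time_fold_cross_out:
  "time (fold_timed (cross_out m) qs xs) =
     (\<Sum>q\<leftarrow>qs. 1 + real (card {x \<in> {m<..2 * m}. q dvd x}))"
  by (induction qs arbitrary: xs) (auto simp: cross_out_def)

lemma two_power_card_prime_divisors_le:
  fixes x :: nat
  assumes "x > 0" "\<And>q. q \<in> Q \<Longrightarrow> prime q"
  shows "2 ^ card {q \<in> Q. q dvd x} \<le> x"
proof -
  have fin: "finite {q \<in> Q. q dvd x}"
    by (rule finite_subset [of _ "{..x}"]) (use assms dvd_imp_le in auto)
  have "2 ^ card {q \<in> Q. q dvd x} = (\<Prod>q\<in>{q \<in> Q. q dvd x}. 2::nat)"
    by simp
  also have "\<dots> \<le> \<Prod>{q \<in> Q. q dvd x}"
    by (intro prod_mono) (use assms prime_ge_2_nat in auto)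
  also have "\<Prod>{q \<in> Q. q dvd x} dvd x"
  proof -
    have "\<Prod>A dvd x" if "finite A" "A \<subseteq> {q \<in> Q. q dvd x}" for A
      using that
    proof (induction A)
      case (insert a A)
      have "coprime a (\<Prod>A)"
        using insert assms by (intro prod_coprime_right) (metis (mono_tags, lifting) insert_iff mem_Collect_eq primes_coprime subsetD)
      then show ?case
        using insert by (auto intro: divides_mult)
    qed auto
    then show ?thesis
      using fin by blast
  qed
  then have "\<Prod>{q \<in> Q. q dvd x} \<le> x"
    using assms by (intro dvd_imp_le)
  finally show ?thesis .
qed


lemma takeWhile_sorted_eq_filter:
  fixes P :: "'a::linorder \<Rightarrow> bool"
  assumes "sorted xs" "\<And>x y. x \<le> y \<Longrightarrow> P y \<Longrightarrow> P x"
  shows "takeWhile P xs = filter P xs"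
  using assms(1)
proof (induction xs)
  case (Cons x xs)
  then have "filter P xs = []" if "\<not> P x"
    using that assms(2) by (auto simp: filter_empty_conv)
  with Cons show ?case
    by simp
qed auto

text \<open>This is why one segment may double the bound: all primes needed for sieving up to 2m are
  already among those up to m.\<close>

lemma prime_square_le_imp_le:
  fixes q :: nat
  assumes "prime q" "q * q \<le> 2 * m"
  shows "q \<le> m"
proof -
  have "2 * q \<le> q * q"
    using prime_ge_2_nat [OF assms(1)] by (rule mult_le_mono1)
  with assms(2) show ?thesis
    by linarith
qed

lemma set_sieving_primes:
  "set (takeWhile (\<lambda>q. q * q \<le> 2 * m) (primes_upto m)) = {q. prime q \<and> q * q \<le> 2 * m}"
proof -
  have "takeWhile (\<lambda>q. q * q \<le> 2 * m) (primes_upto m) = filter (\<lambda>q. q * q \<le> 2 * m) (primes_upto m)"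
  proof (rule takeWhile_sorted_eq_filter)
    show "sorted (primes_upto m)"
      unfolding primes_upto_def by (intro sorted_wrt_filter sorted_upt)
    show "x * x \<le> 2 * m" if "x \<le> y" "y * y \<le> 2 * m" for x y
      using that mult_le_mono by (meson le_trans)
  qed
  moreover have "q \<le> m" if "prime q" "q * q \<le> 2 * m" for q
    using that prime_square_le_imp_le by blast
  ultimately show ?thesis
    by (auto simp: set_primes_upto)
qed

lemma prime_divisor_square_le:
  fixes x :: nat
  assumes "\<not> prime x" "x > 1"
  obtains q where "prime q" "q dvd x" "q * q \<le> x"
proof -
  obtain a where a: "a dvd x" "a \<noteq> 1" "a \<noteq> x"
    using assms by (auto simp: prime_nat_iff)
  then obtain b where "x = a * b"
    by (elim dvdE)
  with a assms(2) have ab: "x = a * b" "a > 1" "b > 1"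
    by (cases a; cases b; auto)+
  define d where "d = min a b"
  have d: "d dvd x" "d * d \<le> x" "d \<noteq> 1"
    using ab by (auto simp: d_def min_def)
  obtain q where q: "prime q" "q dvd d"
    using d(3) prime_factor_nat by blast
  then have "q \<le> d"
    using ab by (intro dvd_imp_le) (auto simp: d_def)
  then have "q * q \<le> d * d"
    by (intro mult_le_mono)
  with q d that show thesis
    by (meson dvd_trans le_trans)
qed

text \<open>A composite cell has a prime divisor whose square is at most x <= 2m. A prime cell is
  never crossed out, since the sieving primes are at most m and the cell exceeds m.\<close>

lemma survivor_iff_prime:
  fixes x :: nat
  assumes "m < x" "x \<le> 2 * m" "m \<ge> 1"
  shows "(\<forall>q. prime q \<and> q * q \<le> 2 * m \<longrightarrow> \<not> q dvd x) \<longleftrightarrow> prime x"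
proof
  assume *: "\<forall>q. prime q \<and> q * q \<le> 2 * m \<longrightarrow> \<not> q dvd x"
  show "prime x"
  proof (rule ccontr)
    assume "\<not> prime x"
    then obtain q where "prime q" "q dvd x" "q * q \<le> x"
      using prime_divisor_square_le [of x] assms by auto
    with * assms(2) show False
      by (meson le_trans)
  qed
next
  assume x: "prime x"
  have "q \<noteq> x" if "prime q" "q * q \<le> 2 * m" for q
    using prime_square_le_imp_le [OF that] assms by simp
  with x show "\<forall>q. prime q \<and> q * q \<le> 2 * m \<longrightarrow> \<not> q dvd x"
    by (metis prime_nat_iff not_prime_1)
qed

text \<open>The bound starts at 2 and doubles, so one exponent describes the whole sieve, and
  sieving a segment is the step from \<open>j\<close> to \<open>Suc j\<close>.\<close>

definition sieved_to :: "nat \<Rightarrow> sieve \<Rightarrow> bool" where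
  "sieved_to j S \<longleftrightarrow> j \<ge> 1 \<and> S = \<lparr>bound = 2 ^ j, primes = primes_upto (2 ^ j)\<rparr>"

lemma result_sieve_segment:
  assumes "sieved_to j S"
  shows "sieved_to (Suc j) (result (sieve_segment S))"
proof -
  define m where "m = (2::nat) ^ j"
  have S: "S = \<lparr>bound = m, primes = primes_upto m\<rparr>" and m: "m \<ge> 1"
    using assms by (auto simp: sieved_to_def m_def)
  have "filter (\<lambda>x. \<forall>q\<in>set (takeWhile (\<lambda>q. q * q \<le> 2 * m) (primes_upto m)). \<not> q dvd x) [m + 1..<2 * m + 1] =
        filter prime [Suc m..<Suc (2 * m)]"
  proof (rule filter_cong)
    fix x assume "x \<in> set [Suc m..<Suc (2 * m)]"
    then show "(\<forall>q\<in>set (takeWhile (\<lambda>q. q * q \<le> 2 * m) (primes_upto m)). \<not> q dvd x) = prime x"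
      unfolding set_sieving_primes using survivor_iff_prime [of m x] m by auto
  qed auto
  then show ?thesis
    using assms primes_upto_append [of m "2 * m"]
    by (simp add: S sieve_segment_def result_fold_cross_out sieved_to_def m_def Let_def)
qed

text \<open>
  Swapping the sum over the sieving primes with the sum over the cells, a cell \<open>x\<close> is crossed out
  at most \<open>log x\<close> times because the product of its prime divisors is at most \<open>x\<close>.
\<close>

lemma time_sieve_segment:
  assumes "sieved_to j S"
  shows "time (sieve_segment S) \<le> real ((j + 4) * 2 ^ j)"
proof -
  define m where "m = (2::nat) ^ j"
  have S: "S = \<lparr>bound = m, primes = primes_upto m\<rparr>" and m: "m \<ge> 1"
    using assms by (auto simp: sieved_to_def m_def)
  define qs where "qs = takeWhile (\<lambda>q. q * q \<le> 2 * m) (primes_upto m)"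
  have qs: "distinct qs" "set qs \<subseteq> {1..m}" "\<And>q. q \<in> set qs \<Longrightarrow> prime q"
    unfolding qs_def set_sieving_primes
    by (auto simp: distinct_takeWhile prime_square_le_imp_le prime_ge_Suc_0_nat)
  have "length qs = card (set qs)"
    using qs by (simp add: distinct_card)
  also have "\<dots> \<le> card {1..m}"
    using qs by (intro card_mono) auto
  finally have len: "length qs \<le> m"
    by simp
  have "(\<Sum>q\<in>set qs. card {x \<in> {m<..2 * m}. q dvd x}) = (\<Sum>x\<in>{m<..2 * m}. card {q \<in> set qs. q dvd x})"
    using sum.swap_restrict [of "set qs" "{m<..2 * m}" "\<lambda>_ _. 1::nat" "\<lambda>q x. q dvd x"] by simp
  also have "\<dots> \<le> (\<Sum>x\<in>{m<..2 * m}. Suc j)"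
  proof (rule sum_mono)
    fix x assume x: "x \<in> {m<..2 * m}"
    have "2 ^ card {q \<in> set qs. q dvd x} \<le> x"
      by (rule two_power_card_prime_divisors_le) (use x qs in auto)
    also have "\<dots> \<le> 2 ^ Suc j"
      using x by (simp add: m_def)
    finally show "card {q \<in> set qs. q dvd x} \<le> Suc j"
      by (rule power_le_imp_le_exp [rotated]) simp
  qed
  also have "\<dots> = m * Suc j"
    by simp
  finally have cross: "(\<Sum>q\<in>set qs. card {x \<in> {m<..2 * m}. q dvd x}) \<le> m * Suc j" .
  have "time (sieve_segment S) =
          1 + real m + (\<Sum>q\<leftarrow>qs. 1 + real (card {x \<in> {m<..2 * m}. q dvd x}))"
    by (simp add: S sieve_segment_def time_fold_cross_out qs_def Let_def)
  also have "(\<Sum>q\<leftarrow>qs. 1 + real (card {x \<in> {m<..2 * m}. q dvd x})) =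
             real (length qs) + real (\<Sum>q\<in>set qs. card {x \<in> {m<..2 * m}. q dvd x})"
    using qs(1) by (simp add: sum_list_distinct_conv_sum_set sum.distrib distinct_card)
  \<comment> \<open>The summands of (j + 4) m: the unit charge (at most m), the m cells, at most m
    sieving primes, and m (j + 1) crossings-out.\<close>
  also have "1 + real m + \<dots> \<le> real m + real m + (real m + real (m * Suc j))"
    using m by (intro add_mono order.refl of_nat_mono len cross) simp
  also have "\<dots> = real ((j + 4) * m)"
    by (simp add: algebra_simps)
  finally show ?thesis
    by (simp add: m_def)
qed

section \<open>Amortised cost of the sieve\<close>

definition sieve_potential :: "sieve \<Rightarrow> real" where
  "sieve_potential S = real (bound S) * (log 2 (real (bound S)) + 4)"

lemma sieve_potential_eq: "sieved_to j S \<Longrightarrow> sieve_potential S = real ((j + 4) * 2 ^ j)"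
  by (simp add: sieve_potential_def sieved_to_def)

text \<open>The potential at bound 2^j equals the cost bound of the next segment and more than
  doubles when the bound does, so its increase pays for that segment. Differences of this kind
  telescope over all calls and levels.\<close>

lemma time_sieve_segment_potential:
  assumes "sieved_to j S"
  shows "time (sieve_segment S) \<le> sieve_potential (result (sieve_segment S)) - sieve_potential S"
proof -
  have "time (sieve_segment S) \<le> real ((j + 4) * 2 ^ j)"
    by (rule time_sieve_segment) fact
  also have "\<dots> \<le> real ((Suc j + 4) * 2 ^ Suc j) - real ((j + 4) * 2 ^ j)"
    by (simp add: algebra_simps)
  finally show ?thesis
    by (simp only: sieve_potential_eq [OF assms] sieve_potential_eq [OF result_sieve_segment [OF assms]])
qed

text \<open>
  The segments before the last one hold at most \<open>K\<close> primes, so by Chebyshev's estimate the sieve has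
  not run far beyond the prime with index \<open>K\<close>.
\<close>

definition lean_sieve :: "nat \<Rightarrow> sieve \<Rightarrow> bool" where
  "lean_sieve K S \<longleftrightarrow>
     (\<exists>j. sieved_to j S \<and> (j = 1 \<or> j \<ge> 2 \<and> length (primes_upto (2 ^ (j - 1))) \<le> K))"

lemma primes_upto_2: "primes_upto 2 = [2]"
  using two_is_prime_nat by (simp add: primes_upto_def upt_rec numeral_2_eq_2)

lemma lean_sieve_initial: "lean_sieve K initial_sieve"
  by (auto simp: lean_sieve_def initial_sieve_def sieved_to_def primes_upto_2 intro!: exI [of _ 1])

lemma lean_sieveD:
  assumes "lean_sieve K S"
  shows "distinct (primes S)" "p \<in> set (primes S) \<longleftrightarrow> prime p \<and> p \<le> bound S"
  using assms by (auto simp: lean_sieve_def sieved_to_def set_primes_upto)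

lemma lean_sieve_bound:
  assumes "lean_sieve K S"
  obtains j where "j \<ge> 1" "bound S = 2 ^ j"
    "j = 1 \<or> 2 ^ (j - 1) \<le> (j - 1) * (K + 2) \<and> 2 ^ (j - 1) \<le> 4 * (K + 2) ^ 2"
proof -
  from assms obtain j where j: "sieved_to j S" "j = 1 \<or> j \<ge> 2 \<and> length (primes_upto (2 ^ (j - 1))) \<le> K"
    by (auto simp: lean_sieve_def)
  show thesis
  proof (rule that [of j])
    show "j = 1 \<or> 2 ^ (j - 1) \<le> (j - 1) * (K + 2) \<and> 2 ^ (j - 1) \<le> 4 * (K + 2) ^ 2"
      using j(2) few_primes_upto_power_2 [of "j - 1" K] by fastforce
  qed (use j in \<open>auto simp: sieved_to_def\<close>)
qed

text \<open>A segment is sieved only while at most \<open>k\<close> primes are known, hence at most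
  \<open>K\<close>, which keeps the sieve lean. That the list of primes is only extended preserves
  the primes already handed out as colours at their indices.\<close>

lemma ensure_prime:
  assumes "lean_sieve K S" "k \<le> K"
  shows "lean_sieve K (result (ensure_prime k S))" (is ?lean)
    and "k < length (primes (result (ensure_prime k S)))" (is ?len)
    and "\<exists>xs. primes (result (ensure_prime k S)) = primes S @ xs" (is ?prefix)
    and "time (ensure_prime k S) \<le>
           1 + sieve_potential (result (ensure_prime k S)) - sieve_potential S" (is ?time)
proof -
  let ?I = "\<lambda>s. lean_sieve K (result s) \<and> (\<exists>xs. primes (result s) = primes S @ xs) \<and>
              time s \<le> 1 + sieve_potential (result s) - sieve_potential S"
  have "?I (ensure_prime k S) \<and> k < length (primes (result (ensure_prime k S)))"
    unfolding ensure_prime_def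
  \<comment> \<open>While the loop runs, at most \<open>k\<close> primes lie below the bound, so the
    bound is at most 4 (k + 2)^2. The \<open>+ 1\<close> keeps the measure positive before the step;
    thus it strictly decreases even if the doubled bound truncates it to 0.\<close>
  proof (rule while_rule [where P = ?I and r = "measure (\<lambda>s. 4 * (k + 2) ^ 2 + 1 - bound (result s))"])
    fix s
    assume s: "?I s" "length (primes (result s)) \<le> k"
    define S' where "S' = result s"
    obtain j where j: "sieved_to j S'"
      using s by (auto simp: lean_sieve_def S'_def)
    have next_j: "sieved_to (Suc j) (result (sieve_segment S'))"
      by (rule result_sieve_segment) fact
    have few: "length (primes_upto (2 ^ j)) \<le> k"
      using s j by (auto simp: sieved_to_def S'_def)
    have "lean_sieve K (result (sieve_segment S'))"
      unfolding lean_sieve_def using next_j few j assms(2)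
      by (intro exI [of _ "Suc j"]) (auto simp: sieved_to_def)
    moreover have "\<exists>xs. primes (result (sieve_segment S')) = primes S @ xs"
    proof -
      have "primes (result (sieve_segment S')) = primes S' @ filter prime [Suc (2 ^ j)..<Suc (2 ^ Suc j)]"
        using j next_j primes_upto_append [of "2 ^ j" "2 ^ Suc j"] by (simp add: sieved_to_def)
      with s show ?thesis
        by (auto simp: S'_def)
    qed
    moreover have "time s + time (sieve_segment S') \<le>
        1 + sieve_potential (result (sieve_segment S')) - sieve_potential S"
      using s time_sieve_segment_potential [OF j] by (simp add: S'_def)
    ultimately show "?I (s \<bind> sieve_segment)"
      by (simp add: S'_def)
    have "2 ^ j \<le> 4 * (k + 2) ^ 2"
      using j few by (intro few_primes_upto_power_2) (auto simp: sieved_to_def)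
    moreover have "bound (result s) = 2 ^ j" "bound (result (sieve_segment S')) = 2 * 2 ^ j"
      using j next_j by (auto simp: sieved_to_def S'_def)
    moreover have "(2::nat) ^ j > 0"
      by simp
    ultimately show "(s \<bind> sieve_segment, s) \<in> measure (\<lambda>s. 4 * (k + 2) ^ 2 + 1 - bound (result s))"
      unfolding in_measure result_bind S'_def by linarith
  qed (use assms in auto)
  then show ?lean ?len ?prefix ?time
    by auto
qed


section \<open>Shapes of trees\<close>

datatype mtree = Node "mtree multiset"

text \<open>Trees are relations and admit no structural recursion, so the recursion runs on a
  height. The level of a node is a sufficient height, since no node of level 0 has children.\<close>

primrec canon :: "'a rtree \<Rightarrow> nat \<Rightarrow> 'a \<Rightarrow> mtree" where
  "canon T 0 = (\<lambda>u. Node {#})"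
| "canon T (Suc h) = (\<lambda>u. Node (image_mset (canon T h) (mset_set (children T u))))"

definition shape :: "'a rtree \<Rightarrow> 'a \<Rightarrow> mtree" where
  "shape T u = canon T (node_level T u) u"

lemma children_iff: "v \<in> children T u \<longleftrightarrow> (u, v) \<in> child T"
  by (simp add: children_def)

section \<open>Depths and levels in a rooted tree\<close>

context
  fixes T :: "'a rtree"
  assumes T: "rooted_tree T"
begin

lemma finite_nodes: "finite (nodes T)"
  and root_in_nodes: "root T \<in> nodes T"
  and child_nodes: "(u, v) \<in> child T \<Longrightarrow> u \<in> nodes T" "(u, v) \<in> child T \<Longrightarrow> v \<in> nodes T"
  and root_not_child: "(u, root T) \<notin> child T"
  and ex1_parent: "v \<in> nodes T \<Longrightarrow> v \<noteq> root T \<Longrightarrow> \<exists>!u. (u, v) \<in> child T"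
  and root_reaches: "v \<in> nodes T \<Longrightarrow> (root T, v) \<in> (child T)\<^sup>*"
  using T by (auto simp: rooted_tree_def)

lemma parent_unique:
  assumes "(u, v) \<in> child T" "(u', v) \<in> child T"
  shows "u = u'"
proof -
  have "v \<in> nodes T" "v \<noteq> root T"
    using assms child_nodes root_not_child by auto
  then show ?thesis
    using ex1_parent assms by blast
qed

lemma children_nodes: "children T u \<subseteq> nodes T"
  using child_nodes by (auto simp: children_iff)

lemma finite_children [intro]: "finite (children T u)"
  using finite_subset [OF children_nodes finite_nodes] .

text \<open>Makes the \<open>THE\<close> in \<open>node_depth\<close> well defined: by uniqueness of
  parents two paths are retraced in step, and neither can go on above the root, which has no
  parent.\<close>

lemma path_length_unique:
  assumes "(root T, u) \<in> child T ^^ k" "(root T, u) \<in> child T ^^ k'"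
  shows "k = k'"
  using assms
proof (induction k arbitrary: u k')
  case 0
  then show ?case
    using root_not_child by (cases k') auto
next
  case (Suc k)
  from Suc.prems(1) obtain w where w: "(root T, w) \<in> child T ^^ k" "(w, u) \<in> child T"
    by auto
  then have "u \<noteq> root T"
    using root_not_child by auto
  with Suc.prems(2) obtain k'' where k'': "k' = Suc k''"
    by (cases k') auto
  with Suc.prems(2) obtain w' where "(root T, w') \<in> child T ^^ k''" "(w', u) \<in> child T"
    by auto
  with w Suc.IH k'' show ?case
    using parent_unique by blast
qed

lemma node_depth_eq:
  assumes "(root T, u) \<in> child T ^^ k"
  shows "node_depth T u = k"
  unfolding node_depth_def using assms path_length_unique by blast

lemma path_of_node_depth:
  assumes "u \<in> nodes T"
  shows "(root T, u) \<in> child T ^^ node_depth T u"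
  using root_reaches [OF assms] node_depth_eq by (auto simp: rtrancl_power)

lemma node_depth_root: "node_depth T (root T) = 0"
  by (rule node_depth_eq) auto

lemma node_depth_child: "(u, v) \<in> child T \<Longrightarrow> node_depth T v = Suc (node_depth T u)"
  by (rule node_depth_eq) (use path_of_node_depth child_nodes in auto)

lemma node_depth_0D: "u \<in> nodes T \<Longrightarrow> node_depth T u = 0 \<Longrightarrow> u = root T"
  using path_of_node_depth by fastforce

lemma node_depth_SucE:
  assumes "u \<in> nodes T" "node_depth T u = Suc n"
  obtains w where "(w, u) \<in> child T" "node_depth T w = n"
  using path_of_node_depth [OF assms(1)] assms(2) node_depth_eq by auto

lemma node_depth_le: "u \<in> nodes T \<Longrightarrow> node_depth T u \<le> tree_depth T"
  unfolding tree_depth_def using finite_nodes by (intro Max_ge) auto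

text \<open>The depth of the child is at most the depth of the tree, so the subtraction in
  \<open>node_level\<close> does not truncate. Consequently the colours read at one level are those
  assigned at the level processed just before.\<close>

lemma node_level_child: "(u, v) \<in> child T \<Longrightarrow> node_level T u = Suc (node_level T v)"
  using node_depth_child [of u v] node_depth_le [of v] child_nodes [of u v]
  by (auto simp: node_level_def)

lemma level_set_nodes: "level_set T d \<subseteq> nodes T"
  by (auto simp: level_set_def)

lemma finite_level_set: "finite (level_set T d)"
  using finite_subset [OF level_set_nodes finite_nodes] .

lemma children_level_set: "u \<in> level_set T (Suc d) \<Longrightarrow> children T u \<subseteq> level_set T d"
  using node_level_child child_nodes by (fastforce simp: level_set_def children_iff)

lemma children_level_0: "u \<in> level_set T 0 \<Longrightarrow> children T u = {}"
  using node_level_child by (fastforce simp: level_set_def children_iff)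

lemma children_disjoint_level_set: "u \<in> level_set T d \<Longrightarrow> children T u \<inter> level_set T d = {}"
  using node_level_child by (fastforce simp: level_set_def children_iff)

lemma level_set_tree_depth: "level_set T (tree_depth T) = {root T}"
proof -
  have "u = root T" if "u \<in> nodes T" "node_level T u = tree_depth T" for u
  proof (rule node_depth_0D)
    show "node_depth T u = 0"
      using that(2) node_depth_le [OF that(1)] by (simp add: node_level_def)
  qed fact
  moreover have "node_level T (root T) = tree_depth T"
    by (simp add: node_level_def node_depth_root)
  ultimately show ?thesis
    unfolding level_set_def using root_in_nodes by blast
qed

lemma UN_level_set: "(\<Union>d<Suc (tree_depth T). level_set T d) = nodes T"
  by (auto simp: level_set_def node_level_def less_Suc_eq_le)

text \<open>Every depth up to the maximum occurs on the path to a deepest node. This later pays for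
  the unit charged per level.\<close>

lemma tree_depth_less_card: "tree_depth T < card (nodes T)"
proof -
  have "\<exists>u\<in>nodes T. node_depth T u = k" if "w \<in> nodes T" "k \<le> node_depth T w" for k w
    using that
  proof (induction "node_depth T w" arbitrary: w)
    case (Suc n)
    then obtain w' where w': "(w', w) \<in> child T" "node_depth T w' = n"
      using node_depth_SucE by metis
    show ?case
    proof (cases "k = Suc n")
      case True
      with Suc show ?thesis
        by auto
    next
      case False
      with Suc.prems Suc.hyps(2) have "k \<le> n"
        by linarith
      with w' show ?thesis
        using Suc.hyps(1) [of w'] child_nodes(1) [OF w'(1)] by simp
    qed
  qed auto
  moreover have "tree_depth T \<in> node_depth T ` nodes T"
    unfolding tree_depth_def using finite_nodes root_in_nodes by (intro Max_in) auto
  ultimately have "{..tree_depth T} \<subseteq> node_depth T ` nodes T"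
    by fastforce
  then have "card {..tree_depth T} \<le> card (node_depth T ` nodes T)"
    using finite_nodes by (intro card_mono) auto
  also have "\<dots> \<le> card (nodes T)"
    using finite_nodes by (rule card_image_le)
  finally show ?thesis
    by simp
qed

lemma sum_card_children_le: "(\<Sum>u\<in>nodes T. card (children T u)) \<le> card (nodes T)"
proof -
  have "(\<Sum>u\<in>nodes T. card (children T u)) = card (\<Union>u\<in>nodes T. children T u)"
    using finite_nodes parent_unique
    by (intro card_UN_disjoint [symmetric]) (auto simp: children_iff)
  also have "\<dots> \<le> card (nodes T)"
    using finite_nodes children_nodes by (intro card_mono) auto
  finally show ?thesis .
qed

text \<open>Eliminates the height from \<open>canon\<close>: a child's level is one less, which is
  the height it receives in the recursion.\<close>

lemma shape_eq: "shape T u = Node (image_mset (shape T) (mset_set (children T u)))"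
proof (cases "node_level T u")
  case 0
  then have "children T u = {}"
    using node_level_child by (fastforce simp: children_iff)
  then show ?thesis
    by (simp add: shape_def 0)
next
  case (Suc h)
  have "shape T v = canon T h v" if "v \<in> children T u" for v
    using that Suc node_level_child by (auto simp: shape_def children_iff)
  then have "image_mset (shape T) (mset_set (children T u)) = image_mset (canon T h) (mset_set (children T u))"
    using finite_children by (intro image_mset_cong) auto
  then show ?thesis
    by (simp add: shape_def Suc)
qed

end

section \<open>Equal shapes and isomorphism\<close>

lemma image_mset_eq_imp_bij_betw:
  assumes "finite A" "finite B" "image_mset f (mset_set A) = image_mset g (mset_set B)"
  shows "\<exists>s. bij_betw s A B \<and> (\<forall>a\<in>A. g (s a) = f a)"
  using assms
proof (induction A arbitrary: B)
  case empty
  then show ?case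
    by (auto simp: mset_set_empty_iff bij_betw_def)
next
  case (insert a A)
  have "f a \<in># image_mset g (mset_set B)"
    using insert.hyps by (simp flip: insert.prems(2))
  then obtain b where b: "b \<in> B" "g b = f a"
    using insert.prems(1) by auto
  have "image_mset g (mset_set B) = add_mset (g b) (image_mset g (mset_set (B - {b})))"
    using b insert.prems(1) by (simp add: mset_set.remove)
  then have "image_mset f (mset_set A) = image_mset g (mset_set (B - {b}))"
    using insert.hyps insert.prems(2) b by simp
  then obtain s where s: "bij_betw s A (B - {b})" "\<forall>a\<in>A. g (s a) = f a"
    using insert.IH [of "B - {b}"] insert.prems(1) by auto
  have "bij_betw (s(a := b)) (insert a A) (insert b (B - {b}))"
  proof (rule bij_betw_combine [where A = "{a}" and C = A and B = "{b}", simplified])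
    show "bij_betw (s(a := b)) A (B - {b})"
      using s(1) insert.hyps(2) by (subst bij_betw_cong [of _ _ s]) auto
  qed (auto simp: bij_betw_def)
  moreover have "insert b (B - {b}) = B"
    using b by auto
  ultimately have "bij_betw (s(a := b)) (insert a A) B"
    by simp
  moreover have "\<forall>x\<in>insert a A. g ((s(a := b)) x) = f x"
    using s(2) b insert.hyps(2) by auto
  ultimately show ?case
    by blast
qed

text \<open>
  Going down from the roots, the isomorphism matches the children of corresponding nodes by a
  bijection that preserves the shapes.
\<close>

lemma shape_eq_imp_tree_iso:
  assumes T1: "rooted_tree T1" and T2: "rooted_tree T2"
    and root: "shape T1 (root T1) = shape T2 (root T2)"
  shows "T1 \<simeq> T2"
proof -
  define parent where "parent x = (THE u. (u, x) \<in> child T1)" for x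
  have parent [simp]: "parent x = u" if "(u, x) \<in> child T1" for u x
    unfolding parent_def using that parent_unique [OF T1] by blast
  \<comment> \<open>A matching is chosen for all pairs of nodes, because the node to which
    \<open>u\<close> will be sent is known only after the recursion. The premise stands inside the
    existential so that the choice is total.\<close>
  have "\<exists>s. shape T1 u = shape T2 v \<longrightarrow> bij_betw s (children T1 u) (children T2 v) \<and>
          (\<forall>w\<in>children T1 u. shape T2 (s w) = shape T1 w)" for u v
    using image_mset_eq_imp_bij_betw [OF finite_children [OF T1] finite_children [OF T2], of "shape T1" u "shape T2" v]
    by (subst shape_eq [OF T1], subst shape_eq [OF T2]) auto
  then obtain s where s:
    "\<And>u v. shape T1 u = shape T2 v \<Longrightarrow> bij_betw (s u v) (children T1 u) (children T2 v)"
    "\<And>u v w. shape T1 u = shape T2 v \<Longrightarrow> w \<in> children T1 u \<Longrightarrow> shape T2 (s u v w) = shape T1 w"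
    by metis
  \<comment> \<open>Recursion along the depth: \<open>phi n\<close> is meaningful for nodes of depth
    \<open>n\<close>, and places a node by the matching chosen for its parent and the image of that
    parent.\<close>
  define phi where "phi = rec_nat (\<lambda>_. root T2) (\<lambda>_ h x. s (parent x) (h (parent x)) x)"
  define \<phi> where "\<phi> x = phi (node_depth T1 x) x" for x
  have \<phi>_root: "\<phi> (root T1) = root T2"
    by (simp add: \<phi>_def phi_def node_depth_root [OF T1])
  have \<phi>_child: "\<phi> v = s u (\<phi> u) v" if "(u, v) \<in> child T1" for u v
    using that node_depth_child [OF T1 that] by (simp add: \<phi>_def phi_def)
  have shape: "shape T2 (\<phi> u) = shape T1 u" if "u \<in> nodes T1" for u
    using that
  proof (induction "node_depth T1 u" arbitrary: u)
    case 0
    then show ?case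
      using node_depth_0D [OF T1] \<phi>_root root by metis
  next
    case (Suc n)
    then obtain w where w: "(w, u) \<in> child T1" "node_depth T1 w = n"
      using node_depth_SucE [OF T1] by metis
    then have "shape T2 (\<phi> w) = shape T1 w"
      using Suc child_nodes [OF T1] by blast
    with w show ?case
      using s(2) [of w "\<phi> w" u] by (simp add: \<phi>_child children_iff)
  qed
  have bij: "bij_betw (s u (\<phi> u)) (children T1 u) (children T2 (\<phi> u))" if "u \<in> nodes T1" for u
    by (rule s(1)) (simp add: shape that)
  have child: "(\<phi> u, \<phi> v) \<in> child T2" if "(u, v) \<in> child T1" for u v
    using bij_betwE [OF bij] that child_nodes [OF T1 that] by (auto simp: \<phi>_child children_iff)
  have depth: "node_depth T2 (\<phi> u) = node_depth T1 u" if "u \<in> nodes T1" for u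
    using that
  proof (induction "node_depth T1 u" arbitrary: u)
    case 0
    then show ?case
      using node_depth_0D [OF T1] \<phi>_root node_depth_root [OF T2] by metis
  next
    case (Suc n)
    then obtain w where w: "(w, u) \<in> child T1" "node_depth T1 w = n"
      using node_depth_SucE [OF T1] by metis
    then show ?case
      using Suc child_nodes [OF T1] node_depth_child [OF T2 child [OF w(1)]] by metis
  qed
  have nodes: "\<phi> u \<in> nodes T2" if "u \<in> nodes T1" for u
  proof (cases "u = root T1")
    case True
    then show ?thesis
      using \<phi>_root root_in_nodes [OF T2] by simp
  next
    case False
    then show ?thesis
      using ex1_parent [OF T1 that] child child_nodes [OF T2] by blast
  qed
  \<comment> \<open>Nodes with equal images have equal depth. Their parents have equal images by
    uniqueness of parents in \<open>T2\<close>, so they coincide by induction, and the matching is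
    injective on siblings.\<close>
  have inj: "u = v" if "u \<in> nodes T1" "v \<in> nodes T1" "\<phi> u = \<phi> v" for u v
    using that
  proof (induction "node_depth T1 u" arbitrary: u v)
    case 0
    then show ?case
      using depth node_depth_0D [OF T1] by metis
  next
    case (Suc n)
    then have "node_depth T1 v = Suc n"
      using depth by metis
    with Suc obtain w w' where w: "(w, u) \<in> child T1" "node_depth T1 w = n" "(w', v) \<in> child T1"
      using node_depth_SucE [OF T1] by metis
    then have "\<phi> w = \<phi> w'"
      using child Suc.prems(3) parent_unique [OF T2] by metis
    then have "w = w'"
      using w Suc.hyps(1) child_nodes [OF T1] by blast
    with w Suc.prems(3) show ?case
      using bij [of w] child_nodes(1) [OF T1 w(1)]
      by (auto simp: \<phi>_child bij_betw_def children_iff dest: inj_onD)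
  qed
  have surj: "y \<in> \<phi> ` nodes T1" if "y \<in> nodes T2" for y
    using that
  proof (induction "node_depth T2 y" arbitrary: y)
    case 0
    then show ?case
      using node_depth_0D [OF T2] \<phi>_root root_in_nodes [OF T1] by (metis imageI)
  next
    case (Suc n)
    then obtain z where z: "(z, y) \<in> child T2" "node_depth T2 z = n"
      using node_depth_SucE [OF T2] by metis
    then obtain u where u: "u \<in> nodes T1" "z = \<phi> u"
      using Suc child_nodes [OF T2] by blast
    then have "y \<in> s u (\<phi> u) ` children T1 u"
      using z bij [of u] by (auto simp: bij_betw_def children_iff)
    then obtain v where "y = s u (\<phi> u) v" "(u, v) \<in> child T1"
      by (auto simp: children_iff)
    then show ?case
      using child_nodes [OF T1] by (metis \<phi>_child imageI)
  qed
  have "(u, v) \<in> child T1" if uv: "u \<in> nodes T1" "v \<in> nodes T1" "(\<phi> u, \<phi> v) \<in> child T2" for u v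
  proof -
    have "v \<noteq> root T1"
      using uv \<phi>_root root_not_child [OF T2] by auto
    then obtain w where w: "(w, v) \<in> child T1"
      using uv ex1_parent [OF T1] by blast
    then have "\<phi> w = \<phi> u"
      using child uv parent_unique [OF T2] by blast
    then show ?thesis
      using inj w uv child_nodes [OF T1] by blast
  qed
  then have "\<forall>u\<in>nodes T1. \<forall>v\<in>nodes T1. (u, v) \<in> child T1 \<longleftrightarrow> (\<phi> u, \<phi> v) \<in> child T2"
    using child by blast
  moreover have "bij_betw \<phi> (nodes T1) (nodes T2)"
    unfolding bij_betw_def using inj surj nodes by (auto intro!: inj_onI)
  ultimately show ?thesis
    unfolding tree_iso_def using \<phi>_root by blast
qed

text \<open>An isomorphism maps the children of \<open>u\<close> onto those of its image. Shapes
  therefore agree by induction on the level, which decreases towards the children, and depths by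
  induction from the root.\<close>

lemma tree_isoE:
  assumes "T1 \<simeq> T2" and T1: "rooted_tree T1" and T2: "rooted_tree T2"
  obtains \<phi> where "bij_betw \<phi> (nodes T1) (nodes T2)"
    "\<And>u. u \<in> nodes T1 \<Longrightarrow> shape T2 (\<phi> u) = shape T1 u"
    "\<And>u. u \<in> nodes T1 \<Longrightarrow> node_depth T2 (\<phi> u) = node_depth T1 u"
proof -
  from assms(1) obtain \<phi> where bij: "bij_betw \<phi> (nodes T1) (nodes T2)"
    and root: "\<phi> (root T1) = root T2"
    and child: "\<And>u v. u \<in> nodes T1 \<Longrightarrow> v \<in> nodes T1 \<Longrightarrow> (u, v) \<in> child T1 \<longleftrightarrow> (\<phi> u, \<phi> v) \<in> child T2"
    unfolding tree_iso_def by blast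
  have children: "children T2 (\<phi> u) = \<phi> ` children T1 u" if "u \<in> nodes T1" for u
  proof (intro equalityI subsetI)
    fix y assume y: "y \<in> children T2 (\<phi> u)"
    then have "y \<in> \<phi> ` nodes T1"
      using children_nodes [OF T2] bij_betw_imp_surj_on [OF bij] by blast
    then obtain v where v: "v \<in> nodes T1" "y = \<phi> v"
      by blast
    with y that have "v \<in> children T1 u"
      using child [of u v] by (simp add: children_iff)
    with v(2) show "y \<in> \<phi> ` children T1 u"
      by blast
  next
    fix y assume "y \<in> \<phi> ` children T1 u"
    then obtain v where v: "v \<in> children T1 u" "y = \<phi> v"
      by blast
    with that show "y \<in> children T2 (\<phi> u)"
      using child [of u v] child_nodes(2) [OF T1, of u v] by (simp add: children_iff)
  qed
  have inj: "inj_on \<phi> (children T1 u)" for u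
    using bij children_nodes [OF T1] by (meson bij_betw_imp_inj_on inj_on_subset)
  have shape: "shape T2 (\<phi> u) = shape T1 u" if "u \<in> nodes T1" for u
    using that
  proof (induction "node_level T1 u" arbitrary: u rule: less_induct)
    case less
    have "image_mset (shape T2) (mset_set (children T2 (\<phi> u))) =
          image_mset (\<lambda>v. shape T2 (\<phi> v)) (mset_set (children T1 u))"
      using children [OF less.prems] inj by (simp add: image_mset_mset_set [symmetric] multiset.map_comp o_def)
    also have "\<dots> = image_mset (shape T1) (mset_set (children T1 u))"
    proof (rule image_mset_cong)
      fix v assume "v \<in># mset_set (children T1 u)"
      then have "(u, v) \<in> child T1"
        using finite_children [OF T1] by (simp add: children_iff)
      then show "shape T2 (\<phi> v) = shape T1 v"
        using less.hyps node_level_child [OF T1] child_nodes [OF T1] by (metis lessI)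
    qed
    finally show ?case
      using shape_eq [OF T1, of u] shape_eq [OF T2, of "\<phi> u"] by simp
  qed
  have depth: "node_depth T2 (\<phi> u) = node_depth T1 u" if "u \<in> nodes T1" for u
    using that
  proof (induction "node_depth T1 u" arbitrary: u)
    case 0
    then show ?case
      using node_depth_0D [OF T1] root node_depth_root [OF T2] by metis
  next
    case (Suc n)
    then obtain w where w: "(w, u) \<in> child T1" "node_depth T1 w = n"
      using node_depth_SucE [OF T1] by metis
    then have "node_depth T2 (\<phi> w) = n" "(\<phi> w, \<phi> u) \<in> child T2"
      using Suc child child_nodes [OF T1] by blast+
    then show ?case
      using node_depth_child [OF T2] Suc.hyps by simp
  qed
  show thesis
    using that bij shape depth by blast
qed

lemma tree_iso_imp_tree_depth_eq:
  assumes "T1 \<simeq> T2" "rooted_tree T1" "rooted_tree T2"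
  shows "tree_depth T1 = tree_depth T2"
proof -
  from tree_isoE [OF assms] obtain \<phi> where \<phi>: "bij_betw \<phi> (nodes T1) (nodes T2)"
    "\<And>u. u \<in> nodes T1 \<Longrightarrow> node_depth T2 (\<phi> u) = node_depth T1 u"
    by metis
  then have "node_depth T2 ` nodes T2 = node_depth T1 ` nodes T1"
    unfolding bij_betw_def by (metis (no_types, lifting) image_cong image_image)
  then show ?thesis
    by (simp add: tree_depth_def)
qed

text \<open>Justifies every early negative answer: a mismatch at any single level rules out
  isomorphism.\<close>

lemma tree_iso_imp_level_shapes_eq:
  assumes "T1 \<simeq> T2" "rooted_tree T1" "rooted_tree T2"
  shows "image_mset (shape T1) (mset_set (level_set T1 d)) = image_mset (shape T2) (mset_set (level_set T2 d))"
proof -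
  from tree_isoE [OF assms] obtain \<phi> where \<phi>: "bij_betw \<phi> (nodes T1) (nodes T2)"
    "\<And>u. u \<in> nodes T1 \<Longrightarrow> shape T2 (\<phi> u) = shape T1 u"
    "\<And>u. u \<in> nodes T1 \<Longrightarrow> node_depth T2 (\<phi> u) = node_depth T1 u"
    by metis
  have level: "node_level T2 (\<phi> u) = node_level T1 u" if "u \<in> nodes T1" for u
    using that \<phi>(3) tree_iso_imp_tree_depth_eq [OF assms] by (simp add: node_level_def)
  have "level_set T2 d = \<phi> ` level_set T1 d"
    unfolding level_set_def bij_betw_imp_surj_on [OF \<phi>(1), symmetric] using level by auto
  moreover have "inj_on \<phi> (level_set T1 d)"
    using \<phi>(1) level_set_nodes [OF assms(2)] by (meson bij_betw_imp_inj_on inj_on_subset)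
  ultimately have "image_mset (shape T2) (mset_set (level_set T2 d)) =
      image_mset (\<lambda>u. shape T2 (\<phi> u)) (mset_set (level_set T1 d))"
    by (simp add: image_mset_mset_set [symmetric] multiset.map_comp o_def)
  also have "\<dots> = image_mset (shape T1) (mset_set (level_set T1 d))"
    using \<phi>(2) level_set_nodes [OF assms(2)] finite_level_set [OF assms(2)]
    by (intro image_mset_cong) auto
  finally show ?thesis ..
qed


section \<open>Products and colours\<close>

lemma result_product: "result (product xs) = prod_list xs"
proof (induction xs rule: product.induct)
  case (3 x y zs)
  define xs where "xs = x # y # zs"
  have "result (product xs) = prod_list (take (length xs div 2) xs) * prod_list (drop (length xs div 2) xs)"
    using 3 by (simp add: xs_def mult_timed_def Let_def)
  also have "\<dots> = prod_list xs"
    by (simp flip: prod_list.append)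
  finally show ?case
    by (simp add: xs_def)
qed auto

text \<open>Both logarithmic factors are replaced by \<open>l\<close>, the iterated one because log
  m <= l < 2^l. This loses only polylogarithmic factors.\<close>

lemma mult_cost_le:
  assumes "m \<le> 2 ^ l" "l \<ge> 1"
  shows "mult_cost m \<le> real m * real l * real l"
proof (cases "m = 0")
  case False
  define y where "y = log 2 (real m)"
  have "y \<ge> 0"
    using False by (simp add: y_def)
  have "real m \<le> 2 ^ l"
    using assms(1) by (metis of_nat_le_iff of_nat_numeral of_nat_power)
  then have y: "y \<le> real l"
    using False by (simp add: y_def log_le_iff powr_realpow)
  have "log 2 y \<le> real l"
  proof (cases "y = 0")
    case False
    have "y \<le> 2 ^ l"
      using y of_nat_less_two_power [of l, where 'a = real] by linarith
    with False \<open>y \<ge> 0\<close> show ?thesis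
      by (simp add: log_le_iff powr_realpow)
  \<comment> \<open>For \<open>y = 0\<close>, that is \<open>m = 1\<close>, the term
    \<open>log 2 y\<close> has the default value 0.\<close>
  qed (simp add: log_def)
  then show ?thesis
    unfolding mult_cost_def y_def [symmetric] using y assms(2)
    by (intro mult_mono) auto
qed (auto simp: mult_cost_def)

lemma prod_list_less_power:
  fixes xs :: "nat list"
  assumes "\<And>x. x \<in> set xs \<Longrightarrow> x < 2 ^ b" "xs \<noteq> []"
  shows "prod_list xs < 2 ^ (b * length xs)"
  using assms(2,1)
proof (induction xs rule: list_nonempty_induct)
  case (cons x xs)
  then have "x * prod_list xs < 2 ^ b * 2 ^ (b * length xs)"
    by (intro mult_strict_mono) auto
  then show ?case
    by (simp add: power_add)
qed auto

text \<open>The halving recursion has at most D + 1 layers. Multiplying out a sublist of length q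
  involves factors of at most b q bits and costs at most (1 + b l^2) q, so each layer costs at most
  (1 + b l^2) times the total length. In the induction \<open>D\<close> drops while \<open>b\<close>
  and \<open>l\<close> stay fixed.\<close>

lemma time_product_le:
  assumes "\<And>x. x \<in> set xs \<Longrightarrow> x < 2 ^ b" "length xs \<le> 2 ^ D" "xs \<noteq> []"
    and "b * length xs \<le> 2 ^ l" "l \<ge> 1"
  shows "time (product xs) \<le> (1 + real b * (real l)\<^sup>2) * (real D + 1) * real (length xs)"
  using assms
proof (induction xs arbitrary: D rule: product.induct)
  case (2 x)
  have "1 \<le> (1 + real b * (real l)\<^sup>2) * (real D + 1)"
    using mult_mono [of 1 "1 + real b * (real l)\<^sup>2" 1 "real D + 1"] by simp
  then show ?case
    by simp
next
  case (3 x y zs)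
  define xs where "xs = x # y # zs"
  define h where "h = length xs div 2"
  define us where "us = take h xs"
  define vs where "vs = drop h xs"
  define C where "C = 1 + real b * (real l)\<^sup>2"
  have C: "C \<ge> 0"
    by (simp add: C_def)
  have len: "length us = h" "length vs = length xs - h" "length us + length vs = length xs"
    by (auto simp: us_def vs_def h_def)
  have h: "h \<ge> 1" "h < length xs"
    by (auto simp: h_def xs_def)
  have ne: "us \<noteq> []" "vs \<noteq> []"
    using h len by auto
  have "D \<noteq> 0"
    using "3.prems"(2) by (cases D) auto
  then obtain D' where D: "D = Suc D'"
    by (cases D) auto
  have half: "length us \<le> 2 ^ D'" "length vs \<le> 2 ^ D'"
  proof -
    have "length xs \<le> 2 * 2 ^ D'"
      using "3.prems"(2) by (simp add: D xs_def)
    then show "length us \<le> 2 ^ D'" "length vs \<le> 2 ^ D'"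
      unfolding len h_def by linarith+
  qed
  have small: "z < 2 ^ b" if "z \<in> set us \<or> z \<in> set vs" for z
    using that set_take_subset set_drop_subset "3.prems"(1) unfolding us_def vs_def xs_def by fast
  have bits: "b * length us \<le> b * length xs" "b * length vs \<le> b * length xs"
    using len by auto
  have bl: "b * length xs \<le> 2 ^ l"
    using "3.prems"(4) by (simp only: xs_def)
  have IH1: "time (product us) \<le> C * (real D' + 1) * real (length us)"
    by (rule "3.IH"(1) [OF xs_def h_def, folded us_def C_def, OF small half(1) ne(1) le_trans [OF bits(1) bl] "3.prems"(5)]) simp
  have IH2: "time (product vs) \<le> C * (real D' + 1) * real (length vs)"
    by (rule "3.IH"(2) [OF xs_def h_def, folded vs_def C_def, OF small half(2) ne(2) le_trans [OF bits(2) bl] "3.prems"(5)]) simp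
  define m where "m = max (floorlog 2 (prod_list us)) (floorlog 2 (prod_list vs))"
  have "prod_list us < 2 ^ (b * length us)" "prod_list vs < 2 ^ (b * length vs)"
    using small ne by (auto intro!: prod_list_less_power)
  then have "floorlog 2 (prod_list us) \<le> b * length us" "floorlog 2 (prod_list vs) \<le> b * length vs"
    by (auto intro!: floorlog_leI)
  with bits have m: "m \<le> b * length xs"
    unfolding m_def by (meson le_trans max.boundedI)
  have "mult_cost m \<le> real m * real l * real l"
    using m bl "3.prems"(5) by (intro mult_cost_le) auto
  also have "\<dots> \<le> real (b * length xs) * real l * real l"
    using m by (intro mult_right_mono of_nat_mono) auto
  finally have "1 + mult_cost m \<le> real (length xs) + real (b * length xs) * real l * real l"
    using h by simp
  also have "\<dots> = C * real (length xs)"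
    by (simp add: C_def algebra_simps power2_eq_square)
  finally have mult: "1 + mult_cost m \<le> C * real (length xs)" .
  have "time (product xs) = time (product us) + time (product vs) + (1 + mult_cost m)"
    by (simp add: xs_def us_def vs_def h_def m_def mult_timed_def Let_def result_product)
  also have "\<dots> \<le> C * (real D' + 1) * real (length us) + C * (real D' + 1) * real (length vs) + C * real (length xs)"
    using IH1 IH2 mult by linarith
  also have "\<dots> = C * (real D + 1) * real (length xs)"
    by (simp add: D len(3) [symmetric] algebra_simps)
  finally show ?case
    by (simp only: xs_def C_def)
qed auto

section \<open>Colouring the nodes of one level\<close>

definition good_state :: "nat \<Rightarrow> (nat \<rightharpoonup> nat) \<Rightarrow> nat \<Rightarrow> sieve \<Rightarrow> bool" where
  "good_state K f k S \<longleftrightarrow>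
     lean_sieve K S \<and> k < length (primes S) \<and> inj_on f (dom f) \<and>
     ran f \<subseteq> set (take (Suc k) (primes S))"

lemma good_state_initial:
  assumes "lean_sieve K S"
  shows "good_state K [1 \<mapsto> 2] 0 S"
proof -
  from assms obtain j where "sieved_to j S"
    by (auto simp: lean_sieve_def)
  then have j: "j \<ge> 1" "primes S = primes_upto (2 ^ j)"
    by (auto simp: sieved_to_def)
  have "(2::nat) \<le> 2 ^ j"
    using j(1) self_le_power [of 2 j] by simp
  then have "primes S = 2 # filter prime [Suc 2..<Suc (2 ^ j)]"
    using primes_upto_append [of 2 "2 ^ j"] by (simp add: j primes_upto_2)
  with assms show ?thesis
    by (simp add: good_state_def)
qed

text \<open>The values of \<open>f\<close> are among the primes of index at most \<open>k\<close>,
  so the prime of index \<open>k + 1\<close> is fresh and \<open>f\<close> stays injective. The 3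
  consists of two ticks and the unit charged by \<open>ensure_prime\<close>.\<close>

lemma process_node:
  assumes "good_state K f k S" "k < K"
    and "result (process_node kids u (c, f, k, S)) = (c', f', k', S')"
  shows "good_state K f' k' S'" and "k' \<le> Suc k" and "f \<subseteq>\<^sub>m f'"
    and "\<exists>p. c' = c(u := p) \<and> f' (prod_list (map c (kids u))) = Some p"
    and "time (process_node kids u (c, f, k, S)) \<le>
           time (product (map c (kids u))) + 3 + sieve_potential S' - sieve_potential S"
proof -
  define N where "N = prod_list (map c (kids u))"
  have "good_state K f' k' S' \<and> k' \<le> Suc k \<and> f \<subseteq>\<^sub>m f' \<and>
        (\<exists>p. c' = c(u := p) \<and> f' N = Some p) \<and>
        time (process_node kids u (c, f, k, S)) \<le>
          time (product (map c (kids u))) + 3 + sieve_potential S' - sieve_potential S"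
  proof (cases "f N")
    case (Some p)
    then show ?thesis
      using assms by (auto simp: process_node_def result_product N_def)
  next
    case None
    define S'' where "S'' = result (ensure_prime (k + 1) S)"
    define p where "p = primes S'' ! (k + 1)"
    have S: "lean_sieve K S"
      using assms by (simp add: good_state_def)
    have k: "k + 1 \<le> K"
      using assms by simp
    note ensure = ensure_prime [OF S k, folded S''_def]
    obtain xs where xs: "primes S'' = primes S @ xs"
      using ensure(3) by blast
    have eq: "c' = c(u := p)" "f' = f(N \<mapsto> p)" "k' = Suc k" "S' = S''"
      using assms(3) None by (auto simp: process_node_def result_product N_def S''_def p_def Let_def)
    have ran: "ran f \<subseteq> set (take (Suc k) (primes S''))"
      using assms(1) by (auto simp: good_state_def xs)
    have "distinct (primes S'')"
      using lean_sieveD(1) [OF ensure(1)] .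
    then have "p \<notin> set (take (Suc k) (primes S''))"
      using ensure(2) by (auto simp: p_def in_set_conv_nth nth_eq_iff_index_eq)
    with ran have p: "p \<notin> ran f"
      by blast
    have "inj_on (f(N \<mapsto> p)) (dom (f(N \<mapsto> p)))"
    proof (rule inj_onI)
      fix x y
      assume "x \<in> dom (f(N \<mapsto> p))" "y \<in> dom (f(N \<mapsto> p))" "(f(N \<mapsto> p)) x = (f(N \<mapsto> p)) y"
      with p assms(1) show "x = y"
        by (auto simp: good_state_def ran_def dest: inj_onD split: if_splits)
    qed
    moreover have "ran (f(N \<mapsto> p)) \<subseteq> set (take (Suc (Suc k)) (primes S''))"
    proof -
      have "take (Suc (Suc k)) (primes S'') = take (Suc k) (primes S'') @ [p]"
        using ensure(2) by (simp add: p_def take_Suc_conv_app_nth)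
      with ran None show ?thesis
        by auto
    qed
    ultimately have "good_state K f' k' S'"
      using ensure by (simp add: good_state_def eq)
    moreover have "f \<subseteq>\<^sub>m f'"
      using None by (auto simp: eq map_le_def)
    moreover have "time (process_node kids u (c, f, k, S)) =
        time (product (map c (kids u))) + 2 + time (ensure_prime (k + 1) S)"
      using None by (simp add: process_node_def result_product N_def Let_def)
    ultimately show ?thesis
      using ensure(4) by (auto simp: eq)
  qed
  then show "good_state K f' k' S'" "k' \<le> Suc k" "f \<subseteq>\<^sub>m f'"
    "\<exists>p. c' = c(u := p) \<and> f' (prod_list (map c (kids u))) = Some p"
    "time (process_node kids u (c, f, k, S)) \<le>
       time (product (map c (kids u))) + 3 + sieve_potential S' - sieve_potential S"
    by (simp_all add: N_def)
qed

lemma process_nodes: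
  assumes "good_state K f k S" "k + length us \<le> K"
    and "result (fold_timed (process_node kids) us (c, f, k, S)) = (c', f', k', S')"
  shows "good_state K f' k' S' \<and> k' \<le> k + length us \<and> f \<subseteq>\<^sub>m f'"
  using assms
proof (induction us arbitrary: c f k S)
  case (Cons u us)
  obtain c1 f1 k1 S1 where 1: "result (process_node kids u (c, f, k, S)) = (c1, f1, k1, S1)"
    by (metis prod_cases4)
  note step = process_node [OF Cons.prems(1) _ 1]
  have "good_state K f' k' S' \<and> k' \<le> k1 + length us \<and> f1 \<subseteq>\<^sub>m f'"
    using Cons step by (intro Cons.IH [of f1 k1 S1 c1]) (auto simp: 1)
  then show ?case
    using step Cons.prems(2) by (auto intro: map_le_trans)
qed auto

text \<open>No child of a visited node is recoloured during the pass, so all keys can be computed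
  from the initial \<open>c\<close>. As the map only grows, the final \<open>f'\<close> still holds
  every colour given out earlier.\<close>

lemma process_nodes_colours:
  assumes "good_state K f k S" "k + length us \<le> K"
    and "result (fold_timed (process_node kids) us (c, f, k, S)) = (c', f', k', S')"
    and "\<And>u. u \<in> set us \<Longrightarrow> set (kids u) \<inter> set us = {}"
  shows "(\<forall>u\<in>set us. f' (prod_list (map c (kids u))) = Some (c' u)) \<and> (\<forall>v. v \<notin> set us \<longrightarrow> c' v = c v)"
  using assms
proof (induction us arbitrary: c f k S)
  case (Cons u us)
  obtain c1 f1 k1 S1 where 1: "result (process_node kids u (c, f, k, S)) = (c1, f1, k1, S1)"
    by (metis prod_cases4)
  have "k < K"
    using Cons.prems(2) by simp
  note step = process_node [OF Cons.prems(1) this 1]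
  from step(4) obtain p where p: "c1 = c(u := p)" "f1 (prod_list (map c (kids u))) = Some p"
    by blast
  have rest: "result (fold_timed (process_node kids) us (c1, f1, k1, S1)) = (c', f', k', S')"
    using Cons.prems(3) by (simp add: 1)
  have k1: "k1 + length us \<le> K"
    using step(2) Cons.prems(2) by simp
  have IH: "(\<forall>w\<in>set us. f' (prod_list (map c1 (kids w))) = Some (c' w)) \<and> (\<forall>v. v \<notin> set us \<longrightarrow> c' v = c1 v)"
    using Cons.prems(4) by (intro Cons.IH [OF step(1) k1 rest]) auto
  have map_eq: "map c1 (kids w) = map c (kids w)" if "w \<in> set (u # us)" for w
    using Cons.prems(4) [OF that] by (auto simp: p)
  have "f1 \<subseteq>\<^sub>m f'"
    using process_nodes [OF step(1) k1 rest] by blast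
  with p(2) have "f' (prod_list (map c (kids u))) = Some p"
    by (metis domI map_le_def)
  then have "f' (prod_list (map c (kids u))) = Some (c' u)"
  proof (cases "u \<in> set us")
    \<comment> \<open>The list may repeat \<open>u\<close>; then a later visit fixes its colour, and
      the induction hypothesis describes it.\<close>
    case True
    then show ?thesis
      using IH map_eq [of u] by (metis list.set_intros(1))
  next
    case False
    with IH p(1) have "c' u = p"
      by simp
    then show ?thesis
      using \<open>f' (prod_list (map c (kids u))) = Some p\<close> by simp
  qed
  moreover have "f' (prod_list (map c (kids w))) = Some (c' w)" if "w \<in> set us" for w
    using that IH map_eq [of w] by (metis list.set_intros(2))
  moreover have "c' v = c v" if "v \<notin> set (u # us)" for v
    using that IH p(1) by simp
  ultimately show ?case
    by auto
qed auto

text \<open>Values of \<open>f\<close> are known primes, hence below \<open>2 ^ b\<close>. The bound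
  on colours ranges over all nodes, coloured or not, and is passed on to the next level. Sieving
  costs telescope along the list.\<close>

lemma process_nodes_time:
  assumes "good_state K f k S" "k + length us \<le> K"
    and "result (fold_timed (process_node kids) us (c, f, k, S)) = (c', f', k', S')"
    and "\<And>v. c v < 2 ^ b" "\<And>u. u \<in> set us \<Longrightarrow> length (kids u) \<le> 2 ^ D"
    and "\<And>S p. lean_sieve K S \<Longrightarrow> p \<in> set (primes S) \<Longrightarrow> p < 2 ^ b"
    and "b * 2 ^ D \<le> 2 ^ l" "l \<ge> 1"
    and A: "A = (1 + real b * (real l)\<^sup>2) * (real D + 1)"
  shows "time (fold_timed (process_node kids) us (c, f, k, S)) \<le>
           (\<Sum>u\<leftarrow>us. A * (real (length (kids u)) + 1) + 3) + sieve_potential S' - sieve_potential S \<and>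
         (\<forall>v. c' v < 2 ^ b)"
  using assms(1-5)
proof (induction us arbitrary: c f k S)
  case (Cons u us)
  obtain c1 f1 k1 S1 where 1: "result (process_node kids u (c, f, k, S)) = (c1, f1, k1, S1)"
    by (metis prod_cases4)
  have "k < K"
    using Cons.prems(2) by simp
  note step = process_node [OF Cons.prems(1) this 1]
  from step(4) obtain p where p: "c1 = c(u := p)" "f1 (prod_list (map c (kids u))) = Some p"
    by blast
  have rest: "result (fold_timed (process_node kids) us (c1, f1, k1, S1)) = (c', f', k', S')"
    using Cons.prems(3) by (simp add: 1)
  have k1: "k1 + length us \<le> K"
    using step(2) Cons.prems(2) by simp
  have "p \<in> ran f1"
    using p(2) by (auto simp: ran_def)
  then have "p \<in> set (primes S1)"
    using step(1) by (auto simp: good_state_def dest: in_set_takeD)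
  then have "p < 2 ^ b"
    using assms(6) step(1) by (auto simp: good_state_def)
  then have c1: "c1 v < 2 ^ b" for v
    using Cons.prems(4) by (simp add: p(1))
  have IH: "time (fold_timed (process_node kids) us (c1, f1, k1, S1)) \<le>
           (\<Sum>u\<leftarrow>us. A * (real (length (kids u)) + 1) + 3) + sieve_potential S' - sieve_potential S1 \<and>
         (\<forall>v. c' v < 2 ^ b)"
    using Cons.prems(5) by (intro Cons.IH [OF step(1) k1 rest c1]) auto
  have "1 \<le> A"
    unfolding A using mult_mono [of 1 "1 + real b * (real l)\<^sup>2" 1 "real D + 1"] by simp
  \<comment> \<open>The empty product of a leaf still costs 1; the \<open>+ 1\<close> together with
    \<open>1 \<le> A\<close> covers it.\<close>
  have "time (product (map c (kids u))) \<le> A * (real (length (kids u)) + 1)"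
  proof (cases "kids u = []")
    case True
    with \<open>1 \<le> A\<close> show ?thesis
      by simp
  next
    case False
    have "b * length (kids u) \<le> b * 2 ^ D"
      using Cons.prems(5) by (intro mult_le_mono2) simp
    also have "\<dots> \<le> 2 ^ l"
      by fact
    finally have "time (product (map c (kids u))) \<le> A * real (length (map c (kids u)))"
      unfolding A using False Cons.prems(4,5) assms(7,8) by (intro time_product_le) auto
    with \<open>1 \<le> A\<close> show ?thesis
      by (simp add: distrib_left)
  qed
  with step(5) IH show ?case
    by (simp add: 1)
qed auto


section \<open>Correctness\<close>

text \<open>A single \<open>g\<close> serves both trees: injectivity lets colours be compared in
  place of shapes, and prime values let a product reveal its factors. The node sets are parameters
  because a level starts with coloured children and ends with the level itself coloured.\<close>

definition coloured_by_shape ::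
  "'a rtree \<Rightarrow> 'b rtree \<Rightarrow> 'a set \<Rightarrow> 'b set \<Rightarrow> ('a \<Rightarrow> nat) \<Rightarrow> ('b \<Rightarrow> nat) \<Rightarrow> bool" where
  "coloured_by_shape T1 T2 A1 A2 c1 c2 \<longleftrightarrow>
     (\<exists>g. inj_on g (shape T1 ` A1 \<union> shape T2 ` A2) \<and>
          (\<forall>x\<in>shape T1 ` A1 \<union> shape T2 ` A2. prime (g x)) \<and>
          (\<forall>u\<in>A1. c1 u = g (shape T1 u)) \<and> (\<forall>u\<in>A2. c2 u = g (shape T2 u)))"

lemma coloured_by_shapeE:
  assumes "coloured_by_shape T1 T2 A1 A2 c1 c2"
  obtains g where "inj_on g (shape T1 ` A1 \<union> shape T2 ` A2)"
    "\<And>x. x \<in> shape T1 ` A1 \<union> shape T2 ` A2 \<Longrightarrow> prime (g x)"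
    "\<And>u. u \<in> A1 \<Longrightarrow> c1 u = g (shape T1 u)" "\<And>u. u \<in> A2 \<Longrightarrow> c2 u = g (shape T2 u)"
  using assms unfolding coloured_by_shape_def by (elim exE conjE) (rule that; simp)

lemma coloured_by_shape_mono:
  assumes "coloured_by_shape T1 T2 A1 A2 c1 c2" "B1 \<subseteq> A1" "B2 \<subseteq> A2"
  shows "coloured_by_shape T1 T2 B1 B2 c1 c2"
proof -
  have "shape T1 ` B1 \<union> shape T2 ` B2 \<subseteq> shape T1 ` A1 \<union> shape T2 ` A2"
    using assms by blast
  with assms show ?thesis
    unfolding coloured_by_shape_def by (meson inj_on_subset subsetD)
qed

primrec shape_key :: "(mtree \<Rightarrow> nat) \<Rightarrow> mtree \<Rightarrow> nat" where
  "shape_key g (Node M) = \<Prod>\<^sub># (image_mset g M)"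

lemma shape_key_inject:
  assumes "inj_on g X" "\<And>x. x \<in> X \<Longrightarrow> prime (g x)" "set_mset M \<subseteq> X" "set_mset M' \<subseteq> X"
    and "shape_key g (Node M) = shape_key g (Node M')"
  shows "M = M'"
proof -
  have "image_mset g M = image_mset g M'"
    using assms by (intro prime_factorization_unique') auto
  then show ?thesis
    using assms(1,3,4) by (intro multiset.inj_map_strong [of M M' g g]) (auto dest: inj_onD)
qed

lemma layoutD:
  assumes "layout_of L T"
  shows "distinct (level_list L d)" "set (level_list L d) = level_set T d"
    and "u \<in> nodes T \<Longrightarrow> distinct (child_list L u)"
    and "u \<in> nodes T \<Longrightarrow> set (child_list L u) = children T u"
  using assms by (auto simp: layout_of_def)

lemma mset_level_list: "layout_of L T \<Longrightarrow> mset (level_list L d) = mset_set (level_set T d)"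
  using layoutD(1,2) mset_set_set by metis

lemma length_level_list: "layout_of L T \<Longrightarrow> length (level_list L d) = card (level_set T d)"
  using layoutD(1,2) distinct_card by metis

lemma length_child_list: "layout_of L T \<Longrightarrow> u \<in> nodes T \<Longrightarrow> length (child_list L u) = card (children T u)"
  using layoutD(3,4) distinct_card by metis

lemma length_level_list_le:
  assumes "rooted_tree T" "layout_of L T"
  shows "length (level_list L d) \<le> card (nodes T)"
  unfolding length_level_list [OF assms(2)]
  using level_set_nodes finite_nodes assms(1) by (metis card_mono)

lemma prod_child_colours:
  assumes T: "rooted_tree T" and L: "layout_of L T" and u: "u \<in> nodes T"
    and c: "\<And>v. v \<in> children T u \<Longrightarrow> c v = g (shape T v)"
  shows "prod_list (map c (child_list L u)) = shape_key g (shape T u)"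
proof -
  have "prod_list (map c (child_list L u)) = \<Prod>\<^sub># (image_mset c (mset (child_list L u)))"
    by (metis mset_map prod_mset_prod_list)
  also have "mset (child_list L u) = mset_set (children T u)"
    using layoutD(3,4) [OF L u] mset_set_set by metis
  also have "image_mset c \<dots> = image_mset (\<lambda>v. g (shape T v)) (mset_set (children T u))"
    using c finite_children [OF T, of u] by (intro image_mset_cong) auto
  finally show ?thesis
    by (subst shape_eq [OF T]) (simp add: multiset.map_comp o_def)
qed

text \<open>The new colouring is \<open>f2\<close> composed with \<open>shape_key g\<close>. The key
  is injective by unique factorization, and \<open>f2\<close> is injective with prime values. The
  colours of \<open>T1\<close> were recorded in \<open>f1\<close>, but the second pass only extends
  that map, so they are values of \<open>f2\<close> as well.\<close>

lemma process_level_colours: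
  assumes T1: "rooted_tree T1" and T2: "rooted_tree T2"
    and L1: "layout_of L1 T1" and L2: "layout_of L2 T2"
    and col: "coloured_by_shape T1 T2 (\<Union>u\<in>level_set T1 d. children T1 u) (\<Union>u\<in>level_set T2 d. children T2 u) c1 c2"
    and good: "good_state K f k S"
    and K: "k + length (level_list L1 d) + length (level_list L2 d) \<le> K"
    and r1: "result (fold_timed (process_node (child_list L1)) (level_list L1 d) (c1, f, k, S)) = (c1', f1, k1, S1)"
    and r2: "result (fold_timed (process_node (child_list L2)) (level_list L2 d) (c2, f1, k1, S1)) = (c2', f2, k2, S2)"
  shows "coloured_by_shape T1 T2 (level_set T1 d) (level_set T2 d) c1' c2'"
proof -
  let ?C1 = "\<Union>u\<in>level_set T1 d. children T1 u" and ?C2 = "\<Union>u\<in>level_set T2 d. children T2 u"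
  obtain g where inj: "inj_on g (shape T1 ` ?C1 \<union> shape T2 ` ?C2)"
    and prime: "\<And>x. x \<in> shape T1 ` ?C1 \<union> shape T2 ` ?C2 \<Longrightarrow> prime (g x)"
    and c1: "\<And>u. u \<in> ?C1 \<Longrightarrow> c1 u = g (shape T1 u)" and c2: "\<And>u. u \<in> ?C2 \<Longrightarrow> c2 u = g (shape T2 u)"
    by (rule coloured_by_shapeE [OF col]) blast
  have K1: "k + length (level_list L1 d) \<le> K"
    using K by simp
  note state1 = process_nodes [OF good K1 r1]
  then have good1: "good_state K f1 k1 S1" and K2: "k1 + length (level_list L2 d) \<le> K"
    using K by auto
  note state2 = process_nodes [OF good1 K2 r2]
  have disj1: "set (child_list L1 u) \<inter> set (level_list L1 d) = {}" if "u \<in> set (level_list L1 d)" for u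
    using that children_disjoint_level_set [OF T1] level_set_nodes [OF T1] layoutD [OF L1] by blast
  have disj2: "set (child_list L2 u) \<inter> set (level_list L2 d) = {}" if "u \<in> set (level_list L2 d)" for u
    using that children_disjoint_level_set [OF T2] level_set_nodes [OF T2] layoutD [OF L2] by blast
  have f1: "f2 (shape_key g (shape T1 u)) = Some (c1' u)" if u: "u \<in> level_set T1 d" for u
  proof -
    have "prod_list (map c1 (child_list L1 u)) = shape_key g (shape T1 u)"
      using u level_set_nodes [OF T1] c1 by (intro prod_child_colours [OF T1 L1]) auto
    then have "f1 (shape_key g (shape T1 u)) = Some (c1' u)"
      using process_nodes_colours [OF good K1 r1 disj1] u layoutD(2) [OF L1] by metis
    then show ?thesis
      using state2 by (metis domI map_le_def)
  qed
  have f2: "f2 (shape_key g (shape T2 u)) = Some (c2' u)" if u: "u \<in> level_set T2 d" for u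
  proof -
    have "prod_list (map c2 (child_list L2 u)) = shape_key g (shape T2 u)"
      using u level_set_nodes [OF T2] c2 by (intro prod_child_colours [OF T2 L2]) auto
    then show ?thesis
      using process_nodes_colours [OF good1 K2 r2 disj2] u layoutD(2) [OF L2] by metis
  qed
  define X where "X = shape T1 ` level_set T1 d \<union> shape T2 ` level_set T2 d"
  \<comment> \<open>On \<open>X\<close> the lookup is always defined, so \<open>the\<close> never
    meets \<open>None\<close> there.\<close>
  define G where "G x = the (f2 (shape_key g x))" for x
  have X: "\<exists>M. x = Node M \<and> set_mset M \<subseteq> shape T1 ` ?C1 \<union> shape T2 ` ?C2" if "x \<in> X" for x
  proof -
    from that consider u where "u \<in> level_set T1 d" "x = shape T1 u" | u where "u \<in> level_set T2 d" "x = shape T2 u"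
      by (auto simp: X_def)
    then show ?thesis
    proof cases
      case 1
      then show ?thesis
        using shape_eq [OF T1, of u] finite_children [OF T1, of u] by auto
    next
      case 2
      then show ?thesis
        using shape_eq [OF T2, of u] finite_children [OF T2, of u] by auto
    qed
  qed
  have f2_X: "f2 (shape_key g x) = Some (G x)" if "x \<in> X" for x
    using that f1 f2 by (auto simp: X_def G_def)
  have good2: "inj_on f2 (dom f2)" "ran f2 \<subseteq> set (primes S2)" "lean_sieve K S2"
    using state2 by (auto simp: good_state_def dest: in_set_takeD)
  have "inj_on G X"
  proof (rule inj_onI)
    fix x y assume xy: "x \<in> X" "y \<in> X" "G x = G y"
    then have "shape_key g x = shape_key g y"
      using good2(1) f2_X by (metis domI inj_onD)
    moreover obtain M N where "x = Node M" "set_mset M \<subseteq> shape T1 ` ?C1 \<union> shape T2 ` ?C2"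
      "y = Node N" "set_mset N \<subseteq> shape T1 ` ?C1 \<union> shape T2 ` ?C2"
      using X xy(1,2) by metis
    ultimately show "x = y"
      using shape_key_inject [OF inj prime] by metis
  qed
  moreover have "prime (G x)" if "x \<in> X" for x
    using f2_X [OF that] good2(2,3) lean_sieveD(2) by (metis ranI subsetD)
  moreover have "c1' u = G (shape T1 u)" if "u \<in> level_set T1 d" for u
    using f1 [OF that] by (simp add: G_def)
  moreover have "c2' u = G (shape T2 u)" if "u \<in> level_set T2 d" for u
    using f2 [OF that] by (simp add: G_def)
  ultimately show ?thesis
    unfolding coloured_by_shape_def X_def [symmetric] by blast
qed

lemma coloured_by_shape_eq_iff:
  assumes "coloured_by_shape T1 T2 A1 A2 c1 c2" "finite A1" "finite A2"
  shows "image_mset c1 (mset_set A1) = image_mset c2 (mset_set A2) \<longleftrightarrow>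
         image_mset (shape T1) (mset_set A1) = image_mset (shape T2) (mset_set A2)"
proof -
  obtain g where g: "inj_on g (shape T1 ` A1 \<union> shape T2 ` A2)"
    "\<And>u. u \<in> A1 \<Longrightarrow> c1 u = g (shape T1 u)" "\<And>u. u \<in> A2 \<Longrightarrow> c2 u = g (shape T2 u)"
    by (rule coloured_by_shapeE [OF assms(1)]) blast
  have "image_mset c1 (mset_set A1) = image_mset g (image_mset (shape T1) (mset_set A1))"
    unfolding multiset.map_comp o_def using g(2) assms(2) by (intro image_mset_cong) auto
  moreover have "image_mset c2 (mset_set A2) = image_mset g (image_mset (shape T2) (mset_set A2))"
    unfolding multiset.map_comp o_def using g(3) assms(3) by (intro image_mset_cong) auto
  moreover have "M = M'" if "image_mset g M = image_mset g M'" "set_mset M \<subseteq> shape T1 ` A1 \<union> shape T2 ` A2"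
    "set_mset M' \<subseteq> shape T1 ` A1 \<union> shape T2 ` A2" for M M'
    using that(2,3) g(1) by (intro multiset.inj_map_strong [OF _ that(1)]) (auto dest: inj_onD)
  ultimately show ?thesis
    using assms(2,3) by auto
qed

text \<open>Induction on the number of levels left. The invariant colours the children of level
  \<open>d\<close>, so it holds vacuously at \<open>d = 0\<close>. Below the top a failed comparison
  refutes isomorphism and a successful one only hands on the colouring; at the top the level is the
  root alone and both outcomes decide.\<close>

lemma result_process_levels:
  assumes T1: "rooted_tree T1" and T2: "rooted_tree T2"
    and L1: "layout_of L1 T1" and L2: "layout_of L2 T2"
    and depth: "tree_depth T1 = tree_depth T2"
    and "d \<le> tree_depth T1" "lean_sieve (card (nodes T1) + card (nodes T2)) S"
    and "coloured_by_shape T1 T2 (\<Union>u\<in>level_set T1 d. children T1 u) (\<Union>u\<in>level_set T2 d. children T2 u) c1 c2"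
  shows "result (process_levels L1 L2 [d..<Suc (tree_depth T1)] c1 c2 S) \<longleftrightarrow> T1 \<simeq> T2"
  using assms(6-8)
proof (induction "tree_depth T1 - d" arbitrary: d c1 c2 S rule: less_induct)
  case less
  define K where "K = card (nodes T1) + card (nodes T2)"
  have good: "good_state K [1 \<mapsto> 2] 0 S"
    unfolding K_def by (intro good_state_initial less.prems)
  have K: "0 + length (level_list L1 d) + length (level_list L2 d) \<le> K"
    using length_level_list_le [OF T1 L1, of d] length_level_list_le [OF T2 L2, of d] by (simp add: K_def)
  obtain c1' f1 k1 S1 where r1:
    "result (fold_timed (process_node (child_list L1)) (level_list L1 d) (c1, [1 \<mapsto> 2], 0, S)) = (c1', f1, k1, S1)"
    by (metis prod_cases4)
  obtain c2' f2 k2 S2 where r2: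
    "result (fold_timed (process_node (child_list L2)) (level_list L2 d) (c2, f1, k1, S1)) = (c2', f2, k2, S2)"
    by (metis prod_cases4)
  have state1: "good_state K f1 k1 S1" "k1 \<le> 0 + length (level_list L1 d)"
    using process_nodes [OF good _ r1] K by auto
  then have "good_state K f2 k2 S2"
    using process_nodes [OF state1(1) _ r2] K by auto
  then have S2: "lean_sieve (card (nodes T1) + card (nodes T2)) S2"
    by (simp add: good_state_def K_def)
  have col: "coloured_by_shape T1 T2 (level_set T1 d) (level_set T2 d) c1' c2'"
    by (rule process_level_colours [OF T1 T2 L1 L2 less.prems(3) good K r1 r2])
  define E where "E \<longleftrightarrow> image_mset (shape T1) (mset_set (level_set T1 d)) = image_mset (shape T2) (mset_set (level_set T2 d))"
  have E: "image_mset c1' (mset (level_list L1 d)) = image_mset c2' (mset (level_list L2 d)) \<longleftrightarrow> E"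
    unfolding E_def mset_level_list [OF L1] mset_level_list [OF L2]
    by (rule coloured_by_shape_eq_iff [OF col finite_level_set [OF T1] finite_level_set [OF T2]])
  have "[d..<Suc (tree_depth T1)] = d # [Suc d..<Suc (tree_depth T1)]"
    using less.prems(1) by (simp add: upt_conv_Cons del: upt_Suc)
  then have res: "result (process_levels L1 L2 [d..<Suc (tree_depth T1)] c1 c2 S) \<longleftrightarrow>
      E \<and> result (process_levels L1 L2 [Suc d..<Suc (tree_depth T1)] c1' c2' S2)"
    by (simp add: r1 r2 E del: upt_Suc One_nat_def)
  show ?case
  proof (cases "d = tree_depth T1")
    case True
    have "E \<longleftrightarrow> T1 \<simeq> T2"
    proof
      assume E
      then have "shape T1 (root T1) = shape T2 (root T2)"
        unfolding E_def True level_set_tree_depth [OF T1]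
        unfolding depth level_set_tree_depth [OF T2] by simp
      then show "T1 \<simeq> T2"
        by (rule shape_eq_imp_tree_iso [OF T1 T2])
    qed (auto simp: E_def intro: tree_iso_imp_level_shapes_eq [OF _ T1 T2])
    with res True show ?thesis
      by simp
  next
    case False
    have "result (process_levels L1 L2 [Suc d..<Suc (tree_depth T1)] c1' c2' S2) \<longleftrightarrow> T1 \<simeq> T2"
    proof (rule less.hyps)
      show "coloured_by_shape T1 T2 (\<Union>u\<in>level_set T1 (Suc d). children T1 u)
              (\<Union>u\<in>level_set T2 (Suc d). children T2 u) c1' c2'"
        using children_level_set [OF T1] children_level_set [OF T2]
        by (intro coloured_by_shape_mono [OF col]) blast+
    qed (use False less.prems(1) S2 in auto)
    with res show ?thesis
      using tree_iso_imp_level_shapes_eq [OF _ T1 T2] E_def by metis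
  qed
qed

lemma result_primes_ahu:
  assumes T1: "rooted_tree T1" and T2: "rooted_tree T2"
    and L1: "layout_of L1 T1" and L2: "layout_of L2 T2"
  shows "result (primes_ahu T1 L1 T2 L2) \<longleftrightarrow> T1 \<simeq> T2"
proof (cases "tree_depth T1 = tree_depth T2")
  case True
  have "(\<Union>u\<in>level_set T1 0. children T1 u) = {}" "(\<Union>u\<in>level_set T2 0. children T2 u) = {}"
    using children_level_0 [OF T1] children_level_0 [OF T2] by auto
  then have "result (process_levels L1 L2 [0..<Suc (tree_depth T1)] (\<lambda>_. 0) (\<lambda>_. 0) initial_sieve) \<longleftrightarrow> T1 \<simeq> T2"
    by (intro result_process_levels [OF T1 T2 L1 L2 True] lean_sieve_initial)
       (auto simp: coloured_by_shape_def)
  with True show ?thesis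
    by (simp add: primes_ahu_def del: upt_Suc)
next
  case False
  then show ?thesis
    using tree_iso_imp_tree_depth_eq [OF _ T1 T2] by (auto simp: primes_ahu_def)
qed


section \<open>Running time\<close>

text \<open>\<open>P\<close> minus the current potential is the budget left for sieving on all
  remaining levels. The 4 per node is the 3 from its processing plus 1 for the multiset
  comparison.\<close>

lemma time_process_levels:
  assumes bits: "\<And>S p. lean_sieve K S \<Longrightarrow> p \<in> set (primes S) \<Longrightarrow> p < 2 ^ b"
    and potential: "\<And>S. lean_sieve K S \<Longrightarrow> sieve_potential S \<le> P"
    and l: "b * 2 ^ D \<le> 2 ^ l" "l \<ge> 1"
    and A: "A = (1 + real b * (real l)\<^sup>2) * (real D + 1)"
    and "\<And>d. d \<in> set ds \<Longrightarrow> length (level_list L1 d) + length (level_list L2 d) \<le> K"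
    and "\<And>d u. d \<in> set ds \<Longrightarrow> u \<in> set (level_list L1 d) \<Longrightarrow> length (child_list L1 u) \<le> 2 ^ D"
    and "\<And>d u. d \<in> set ds \<Longrightarrow> u \<in> set (level_list L2 d) \<Longrightarrow> length (child_list L2 u) \<le> 2 ^ D"
    and "lean_sieve K S" "\<And>u. c1 u < 2 ^ b" "\<And>u. c2 u < 2 ^ b"
  shows "time (process_levels L1 L2 ds c1 c2 S) \<le>
     (\<Sum>d\<leftarrow>ds. 1 + (\<Sum>u\<leftarrow>level_list L1 d. A * (real (length (child_list L1 u)) + 1) + 4)
                + (\<Sum>u\<leftarrow>level_list L2 d. A * (real (length (child_list L2 u)) + 1) + 4))
     + P - sieve_potential S"
  using assms(6-)
proof (induction ds arbitrary: c1 c2 S)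
  case Nil
  then show ?case
    using potential by simp
next
  case (Cons d ds)
  let ?us = "level_list L1 d" and ?vs = "level_list L2 d"
  have A0: "A \<ge> 0"
    by (simp add: A)
  have good: "good_state K [1 \<mapsto> 2] 0 S"
    by (rule good_state_initial) fact
  have K: "0 + length ?us + length ?vs \<le> K"
    using Cons.prems(1) [of d] by simp
  obtain c1' f1 k1 S1 where r1:
    "result (fold_timed (process_node (child_list L1)) ?us (c1, [1 \<mapsto> 2], 0, S)) = (c1', f1, k1, S1)"
    by (metis prod_cases4)
  obtain c2' f2 k2 S2 where r2:
    "result (fold_timed (process_node (child_list L2)) ?vs (c2, f1, k1, S1)) = (c2', f2, k2, S2)"
    by (metis prod_cases4)
  have K1: "0 + length ?us \<le> K"
    using K by simp
  have state1: "good_state K f1 k1 S1" and K2: "k1 + length ?vs \<le> K"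
    using process_nodes [OF good K1 r1] K by auto
  have "good_state K f2 k2 S2"
    using process_nodes [OF state1 K2 r2] by blast
  then have S2: "lean_sieve K S2"
    by (simp add: good_state_def)
  have split4: "(\<Sum>u\<leftarrow>us. g u + 4) = (\<Sum>u\<leftarrow>us. g u + 3) + real (length us)" for us :: "'c list" and g
    by (induction us) auto
  have t1: "time (fold_timed (process_node (child_list L1)) ?us (c1, [1 \<mapsto> 2], 0, S)) \<le>
      (\<Sum>u\<leftarrow>?us. A * (real (length (child_list L1 u)) + 1) + 3) + sieve_potential S1 - sieve_potential S \<and>
      (\<forall>u. c1' u < 2 ^ b)"
    using Cons.prems(2,5) by (intro process_nodes_time [OF good K1 r1 _ _ bits l A]) auto
  have t2: "time (fold_timed (process_node (child_list L2)) ?vs (c2, f1, k1, S1)) \<le>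
      (\<Sum>u\<leftarrow>?vs. A * (real (length (child_list L2 u)) + 1) + 3) + sieve_potential S2 - sieve_potential S1 \<and>
      (\<forall>u. c2' u < 2 ^ b)"
    using Cons.prems(3,6) by (intro process_nodes_time [OF state1 K2 r2 _ _ bits l A]) auto
  let ?rest = "(\<Sum>d\<leftarrow>ds. 1 + (\<Sum>u\<leftarrow>level_list L1 d. A * (real (length (child_list L1 u)) + 1) + 4)
                + (\<Sum>u\<leftarrow>level_list L2 d. A * (real (length (child_list L2 u)) + 1) + 4))"
  define R where "R = time (if image_mset c1' (mset ?us) \<noteq> image_mset c2' (mset ?vs) then return False
      else process_levels L1 L2 ds c1' c2' S2)"
  have "R \<le> ?rest + P - sieve_potential S2"
  proof (cases "image_mset c1' (mset ?us) = image_mset c2' (mset ?vs)")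
    case True
    have "time (process_levels L1 L2 ds c1' c2' S2) \<le> ?rest + P - sieve_potential S2"
    proof (rule Cons.IH)
      show "length (level_list L1 d') + length (level_list L2 d') \<le> K" if "d' \<in> set ds" for d'
        using that by (intro Cons.prems) simp
      show "length (child_list L1 u) \<le> 2 ^ D" if "d' \<in> set ds" "u \<in> set (level_list L1 d')" for d' u
        by (rule Cons.prems(2) [OF _ that(2)]) (simp add: that(1))
      show "length (child_list L2 u) \<le> 2 ^ D" if "d' \<in> set ds" "u \<in> set (level_list L2 d')" for d' u
        by (rule Cons.prems(3) [OF _ that(2)]) (simp add: that(1))
    qed (use S2 t1 t2 in auto)
    with True show ?thesis
      by (simp add: R_def)
  next
    case False
    \<comment> \<open>After an early exit the bound still contains the levels that were skipped;
      their contribution is nonnegative.\<close>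
    have "?rest \<ge> 0"
      using A0 by (intro sum_list_nonneg) (auto intro!: add_nonneg_nonneg sum_list_nonneg)
    with False show ?thesis
      using potential [OF S2] by (simp add: R_def)
  qed
  moreover have "time (process_levels L1 L2 (d # ds) c1 c2 S) =
      time (fold_timed (process_node (child_list L1)) ?us (c1, [1 \<mapsto> 2], 0, S)) +
      time (fold_timed (process_node (child_list L2)) ?vs (c2, f1, k1, S1)) +
      (1 + real (length ?us) + real (length ?vs)) + R"
    by (simp add: r1 r2 R_def del: One_nat_def)
  ultimately show ?case
    using t1 t2 split4 [of "\<lambda>u. A * (real (length (child_list L1 u)) + 1)" ?us]
      split4 [of "\<lambda>u. A * (real (length (child_list L2 u)) + 1)" ?vs] by simp
qed

section \<open>Summation over the levels and explicit constants\<close>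

lemma sum_level_lists:
  fixes F :: "'a \<Rightarrow> real"
  assumes T: "rooted_tree T" and L: "layout_of L T"
  shows "(\<Sum>d\<leftarrow>[0..<Suc (tree_depth T)]. \<Sum>u\<leftarrow>level_list L d. F u) = (\<Sum>u\<in>nodes T. F u)"
proof -
  have "(\<Sum>d\<leftarrow>[0..<Suc (tree_depth T)]. \<Sum>u\<leftarrow>level_list L d. F u) =
        (\<Sum>d<Suc (tree_depth T). \<Sum>u\<in>level_set T d. F u)"
    using layoutD(1,2) [OF L]
    by (simp add: sum_list_distinct_conv_sum_set atLeast0LessThan del: upt_Suc sum.lessThan_Suc)
  also have "\<dots> = (\<Sum>u\<in>(\<Union>d<Suc (tree_depth T). level_set T d). F u)"
    using finite_level_set [OF T] by (intro sum.UNION_disjoint [symmetric]) (auto simp: level_set_def)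
  finally show ?thesis
    by (simp only: UN_level_set [OF T])
qed

text \<open>The prime estimate is used twice. The quadratic form with 2n + 2 <= 2^(D+2) gives
  2^(j-1) <= 2^(2D+6), so j <= 2D + 7. Inserting this into the form with the factor j - 1 improves
  the bound to 2^j <= (16D + 48) n, linear in n up to a logarithm.\<close>

lemma lean_sieve_bounds:
  assumes S: "lean_sieve (2 * n) S" and n: "n \<ge> 1" "n \<le> 2 ^ D"
  shows "p \<in> set (primes S) \<Longrightarrow> p < 2 ^ (2 * D + 8)"
    and "sieve_potential S \<le> (2 * real D + 11) * (16 * real D + 48) * real n"
proof -
  from lean_sieve_bound [OF S] obtain j where j: "j \<ge> 1" "bound S = 2 ^ j"
    "j = 1 \<or> 2 ^ (j - 1) \<le> (j - 1) * (2 * n + 2) \<and> 2 ^ (j - 1) \<le> 4 * (2 * n + 2) ^ 2"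
    by blast
  have jD: "j \<le> 2 * D + 7"
  proof (cases "j = 1")
    case False
    have "2 ^ (j - 1) \<le> 4 * (2 * n + 2) ^ 2"
      using False j(3) by blast
    also have "\<dots> \<le> 4 * (2 ^ (D + 2)) ^ 2"
      using n by (intro mult_le_mono2 power_mono) auto
    also have "\<dots> = 2 ^ (2 + (D + 2) * 2)"
      by (simp only: power_add power_mult) simp
    finally have "j - 1 \<le> 2 + (D + 2) * 2"
      by (rule power_le_imp_le_exp [rotated]) simp
    then show ?thesis
      by simp
  qed auto
  show "p < 2 ^ (2 * D + 8)" if "p \<in> set (primes S)"
  proof -
    have "p \<le> 2 ^ j"
      using lean_sieveD(2) [OF S, of p] that j(2) by simp
    also have "\<dots> < 2 ^ (2 * D + 8)"
      using jD by (intro power_strict_increasing) auto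
    finally show ?thesis .
  qed
  have "(2::nat) ^ j \<le> (16 * D + 48) * n"
  proof (cases "j = 1")
    case True
    then show ?thesis
      using n(1) by (cases n) auto
  next
    case False
    then have "2 ^ (j - 1) \<le> (j - 1) * (2 * n + 2)"
      using j(3) by blast
    also have "\<dots> \<le> (2 * D + 6) * (4 * n)"
      using jD n(1) by (intro mult_le_mono) auto
    finally have "2 * 2 ^ (j - 1) \<le> 2 * ((2 * D + 6) * (4 * n))"
      by (rule mult_le_mono2)
    moreover have "(2::nat) ^ j = 2 * 2 ^ (j - 1)"
      using j(1) by (cases j) auto
    ultimately show ?thesis
      by (simp add: algebra_simps)
  qed
  then have "real (2 ^ j) \<le> real ((16 * D + 48) * n)"
    by (rule of_nat_mono)
  moreover have "sieve_potential S = (real j + 4) * real (2 ^ j)"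
    by (simp add: sieve_potential_def j(2))
  moreover have "real j + 4 \<le> 2 * real D + 11"
    using jD by linarith
  ultimately have "sieve_potential S \<le> (2 * real D + 11) * real ((16 * D + 48) * n)"
    by (simp only:) (intro mult_mono, auto)
  then show "sieve_potential S \<le> (2 * real D + 11) * (16 * real D + 48) * real n"
    by (simp add: mult.assoc)
qed

text \<open>Each node is a child of at most one node, so the numbers of children contribute
  \<open>A\<close> per node, and the \<open>+ 1\<close> contributes another
  \<open>A\<close>.\<close>

lemma sum_node_costs_le:
  assumes T: "rooted_tree T" and L: "layout_of L T" and "A \<ge> 0"
  shows "(\<Sum>u\<in>nodes T. A * (real (length (child_list L u)) + 1) + 4) \<le> (2 * A + 4) * real (card (nodes T))"
proof -
  have "(\<Sum>u\<in>nodes T. A * (real (length (child_list L u)) + 1) + 4) =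
        A * real (\<Sum>u\<in>nodes T. card (children T u)) + (A + 4) * real (card (nodes T))"
    using length_child_list [OF L] by (simp add: sum.distrib sum_distrib_left algebra_simps)
  also have "\<dots> \<le> A * real (card (nodes T)) + (A + 4) * real (card (nodes T))"
    using sum_card_children_le [OF T] \<open>A \<ge> 0\<close> by (intro add_right_mono mult_left_mono of_nat_mono)
  finally show ?thesis
    by (simp add: algebra_simps)
qed

text \<open>The 11 is 2 for the initial traversals, 1 for the levels and 4 for the nodes of each
  tree. The last product is the sieve potential.\<close>

lemma time_primes_ahu:
  assumes T1: "rooted_tree T1" and T2: "rooted_tree T2"
    and L1: "layout_of L1 T1" and L2: "layout_of L2 T2"
    and n1: "card (nodes T1) = n" and n2: "card (nodes T2) = n" and D: "n \<le> 2 ^ D"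
    and A: "A = (1 + real (2 * D + 8) * (real (3 * D + 8))\<^sup>2) * (real D + 1)"
  shows "time (primes_ahu T1 L1 T2 L2) \<le> (11 + 4 * A + (2 * real D + 11) * (16 * real D + 48)) * real n"
proof -
  define P where "P = (2 * real D + 11) * (16 * real D + 48) * real n"
  have A0: "A \<ge> 0" and P0: "P \<ge> 0"
    by (simp_all add: A P_def)
  have n: "n \<ge> 1"
    using finite_nodes [OF T1] root_in_nodes [OF T1] n1 by (metis One_nat_def Suc_leI card_gt_0_iff empty_iff)
  show ?thesis
  proof (cases "tree_depth T1 = tree_depth T2")
    case False
    then have "time (primes_ahu T1 L1 T2 L2) = 2 * real n"
      by (simp add: primes_ahu_def n1 n2)
    also have "\<dots> \<le> (11 + 4 * A + (2 * real D + 11) * (16 * real D + 48)) * real n"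
      using A0 by (intro mult_right_mono) (auto intro!: add_increasing2)
    finally show ?thesis .
  next
    case depth: True
    have le1: "length (child_list L1 u) \<le> 2 ^ D" if "u \<in> nodes T1" for u
      unfolding length_child_list [OF L1 that]
      using card_mono [OF finite_nodes [OF T1] children_nodes [OF T1]] n1 D le_trans by blast
    have le2: "length (child_list L2 u) \<le> 2 ^ D" if "u \<in> nodes T2" for u
      unfolding length_child_list [OF L2 that]
      using card_mono [OF finite_nodes [OF T2] children_nodes [OF T2]] n2 D le_trans by blast
    \<comment> \<open>From b <= 2^b with b = 2D + 8: this is where the exponent l = 3D + 8 comes
      from.\<close>
    have "(2 * D + 8) * 2 ^ D \<le> 2 ^ (2 * D + 8) * 2 ^ D"
      using less_exp [of "2 * D + 8"] by (intro mult_le_mono1) simp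
    also have "\<dots> = (2::nat) ^ (3 * D + 8)"
      by (simp add: power_add flip: mult_2) (simp add: power_add [symmetric])
    finally have l: "(2 * D + 8) * 2 ^ D \<le> 2 ^ (3 * D + 8)" .
    let ?c1 = "\<lambda>u. A * (real (length (child_list L1 u)) + 1) + 4"
    let ?c2 = "\<lambda>u. A * (real (length (child_list L2 u)) + 1) + 4"
    let ?ds = "[0..<Suc (tree_depth T1)]"
    have "time (process_levels L1 L2 ?ds (\<lambda>_. 0) (\<lambda>_. 0) initial_sieve) \<le>
       (\<Sum>d\<leftarrow>?ds. 1 + (\<Sum>u\<leftarrow>level_list L1 d. ?c1 u) + (\<Sum>u\<leftarrow>level_list L2 d. ?c2 u))
       + P - sieve_potential initial_sieve"
    proof (rule time_process_levels [where K = "2 * n" and b = "2 * D + 8" and l = "3 * D + 8" and D = D])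
      show "p < 2 ^ (2 * D + 8)" if "lean_sieve (2 * n) S" "p \<in> set (primes S)" for S p
        using lean_sieve_bounds(1) [OF that(1) n D that(2)] .
      show "sieve_potential S \<le> P" if "lean_sieve (2 * n) S" for S
        unfolding P_def using lean_sieve_bounds(2) [OF that n D] .
      show "length (level_list L1 d) + length (level_list L2 d) \<le> 2 * n" for d
        using length_level_list_le [OF T1 L1, of d] length_level_list_le [OF T2 L2, of d] n1 n2 by simp
      show "length (child_list L1 u) \<le> 2 ^ D" if "u \<in> set (level_list L1 d)" for d u
        using that layoutD(2) [OF L1] level_set_nodes [OF T1] by (intro le1) auto
      show "length (child_list L2 u) \<le> 2 ^ D" if "u \<in> set (level_list L2 d)" for d u
        using that layoutD(2) [OF L2] level_set_nodes [OF T2] by (intro le2) auto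
    qed (use l A lean_sieve_initial in auto)
    also have "(\<Sum>d\<leftarrow>?ds. 1 + (\<Sum>u\<leftarrow>level_list L1 d. ?c1 u) + (\<Sum>u\<leftarrow>level_list L2 d. ?c2 u)) =
        real (Suc (tree_depth T1)) + (\<Sum>u\<in>nodes T1. ?c1 u) + (\<Sum>u\<in>nodes T2. ?c2 u)"
    proof -
      have "(\<Sum>d\<leftarrow>ds. 1 + g d + h d) = real (length ds) + (\<Sum>d\<leftarrow>ds. g d) + (\<Sum>d\<leftarrow>ds. h d)"
        for ds :: "nat list" and g h :: "nat \<Rightarrow> real"
        by (induction ds) auto
      then show ?thesis
        unfolding sum_level_lists [OF T1 L1, symmetric] sum_level_lists [OF T2 L2, symmetric] depth
        by (simp del: upt_Suc)
    qed
    finally have levels: "time (process_levels L1 L2 ?ds (\<lambda>_. 0) (\<lambda>_. 0) initial_sieve) \<le>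
        real (Suc (tree_depth T1)) + (\<Sum>u\<in>nodes T1. ?c1 u) + (\<Sum>u\<in>nodes T2. ?c2 u)
        + P - sieve_potential initial_sieve" .
    have "sieve_potential initial_sieve \<ge> 0"
      by (simp add: sieve_potential_def initial_sieve_def)
    moreover have "real (Suc (tree_depth T1)) \<le> real n"
      using tree_depth_less_card [OF T1] n1 by simp
    moreover have "(\<Sum>u\<in>nodes T1. ?c1 u) \<le> (2 * A + 4) * real n"
      using sum_node_costs_le [OF T1 L1 A0] n1 by simp
    moreover have "(\<Sum>u\<in>nodes T2. ?c2 u) \<le> (2 * A + 4) * real n"
      using sum_node_costs_le [OF T2 L2 A0] n2 by simp
    moreover have "time (primes_ahu T1 L1 T2 L2) =
        2 * real n + time (process_levels L1 L2 ?ds (\<lambda>_. 0) (\<lambda>_. 0) initial_sieve)"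
      using depth by (simp add: primes_ahu_def n1 n2 del: upt_Suc)
    moreover have "(11 + 4 * A + (2 * real D + 11) * (16 * real D + 48)) * real n =
        2 * real n + real n + (2 * A + 4) * real n + (2 * A + 4) * real n + P"
      by (simp add: P_def algebra_simps)
    ultimately show ?thesis
      using levels by linarith
  qed
qed

text \<open>Every linear form in D is at most a multiple of B, as D <= 2B and 1 <= B; all powers are
  then raised to B^4. The constant is 11 + 4 * 7059 + 1200, with 7059 = 3 * (12 * 14^2 + 1) and 1200
  = 15 * 80.\<close>

lemma polylog_bound:
  fixes B D :: real
  assumes "B \<ge> 1" "0 \<le> D" "D \<le> 2 * B"
  shows "11 + 4 * ((1 + (2 * D + 8) * (3 * D + 8)\<^sup>2) * (D + 1)) + (2 * D + 11) * (16 * D + 48) \<le> 29447 * B ^ 4"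
proof -
  have B: "1 \<le> B ^ 3" "1 \<le> B ^ 4" "B ^ 2 \<le> B ^ 4"
    using assms(1) by (auto intro: one_le_power power_increasing)
  have "(3 * D + 8)\<^sup>2 \<le> (14 * B)\<^sup>2"
    using assms by (intro power_mono) auto
  then have "(2 * D + 8) * (3 * D + 8)\<^sup>2 \<le> (12 * B) * (14 * B)\<^sup>2"
    using assms by (intro mult_mono) auto
  also have "\<dots> = 2352 * B ^ 3"
    by (simp add: power2_eq_square power3_eq_cube)
  finally have "1 + (2 * D + 8) * (3 * D + 8)\<^sup>2 \<le> 2353 * B ^ 3"
    using B by linarith
  then have "(1 + (2 * D + 8) * (3 * D + 8)\<^sup>2) * (D + 1) \<le> (2353 * B ^ 3) * (3 * B)"
    using assms by (intro mult_mono) auto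
  also have "\<dots> = 7059 * B ^ 4"
    by (simp add: power3_eq_cube power4_eq_xxxx)
  finally have 1: "(1 + (2 * D + 8) * (3 * D + 8)\<^sup>2) * (D + 1) \<le> 7059 * B ^ 4" .
  have "(2 * D + 11) * (16 * D + 48) \<le> (15 * B) * (80 * B)"
    using assms by (intro mult_mono) auto
  also have "\<dots> = 1200 * B ^ 2"
    by (simp add: power2_eq_square)
  finally have "(2 * D + 11) * (16 * D + 48) \<le> 1200 * B ^ 4"
    using B by linarith
  with 1 B show ?thesis
    by linarith
qed

lemma time_primes_ahu_polylog:
  assumes T1: "rooted_tree T1" and T2: "rooted_tree T2"
    and L1: "layout_of L1 T1" and L2: "layout_of L2 T2"
    and n: "card (nodes T1) = n" "card (nodes T2) = n" and B: "B \<ge> 1" "log 2 (real n) \<le> B"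
  shows "time (primes_ahu T1 L1 T2 L2) \<le> (29447 * B ^ 4) * real n"
proof -
  \<comment> \<open>Rounding up makes \<open>D\<close> an integer exponent with
    \<open>n \<le> 2 ^ D\<close>; it at most doubles \<open>B\<close> because \<open>B\<close> is at
    least 1.\<close>
  define D where "D = nat \<lceil>B\<rceil>"
  have D: "B \<le> real D" "real D \<le> 2 * B"
    using B(1) unfolding D_def by linarith+
  have "n > 0"
    using finite_nodes [OF T1] root_in_nodes [OF T1] n(1) by (metis card_gt_0_iff empty_iff)
  then have "real n \<le> 2 powr real D"
    using B(2) D(1) by (simp flip: log_le_iff)
  then have nD: "n \<le> 2 ^ D"
    by (simp add: powr_realpow)
  have "time (primes_ahu T1 L1 T2 L2) \<le>
      (11 + 4 * ((1 + real (2 * D + 8) * (real (3 * D + 8))\<^sup>2) * (real D + 1)) + (2 * real D + 11) * (16 * real D + 48)) * real n"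
    by (rule time_primes_ahu [OF T1 T2 L1 L2 n nD refl])
  also have "\<dots> \<le> (29447 * B ^ 4) * real n"
    using polylog_bound [OF B(1) _ D(2)] by (intro mult_right_mono) simp_all
  finally show ?thesis .
qed

theorem theorem2:
  shows "(\<forall>(T1 :: 'a rtree) (T2 :: 'b rtree) L1 L2.
            rooted_tree T1 \<longrightarrow> rooted_tree T2 \<longrightarrow> layout_of L1 T1 \<longrightarrow> layout_of L2 T2 \<longrightarrow>
            (result (primes_ahu T1 L1 T2 L2) \<longleftrightarrow> T1 \<simeq> T2)) \<and>
         (\<exists>(c :: real) (e :: nat). \<forall>B \<ge> 1.
            \<forall>(T1 :: 'a rtree) (T2 :: 'b rtree) L1 L2 (n :: nat).
              rooted_tree T1 \<longrightarrow> rooted_tree T2 \<longrightarrow> layout_of L1 T1 \<longrightarrow> layout_of L2 T2 \<longrightarrow>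
              card (nodes T1) = n \<longrightarrow> card (nodes T2) = n \<longrightarrow>
              log 2 (real n) \<le> B \<longrightarrow>
              time (primes_ahu T1 L1 T2 L2) \<le> (c * B ^ e) * real n)"
proof (intro conjI exI)
  show "\<forall>(T1 :: 'a rtree) (T2 :: 'b rtree) L1 L2.
      rooted_tree T1 \<longrightarrow> rooted_tree T2 \<longrightarrow> layout_of L1 T1 \<longrightarrow> layout_of L2 T2 \<longrightarrow>
      (result (primes_ahu T1 L1 T2 L2) \<longleftrightarrow> T1 \<simeq> T2)"
    by (blast intro: result_primes_ahu [THEN iffD1] result_primes_ahu [THEN iffD2])
  show "\<forall>B\<ge>1. \<forall>(T1 :: 'a rtree) (T2 :: 'b rtree) L1 L2 (n :: nat).
      rooted_tree T1 \<longrightarrow> rooted_tree T2 \<longrightarrow> layout_of L1 T1 \<longrightarrow> layout_of L2 T2 \<longrightarrow>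
      card (nodes T1) = n \<longrightarrow> card (nodes T2) = n \<longrightarrow>
      log 2 (real n) \<le> B \<longrightarrow>
      time (primes_ahu T1 L1 T2 L2) \<le> (29447 * B ^ 4) * real n"
    by (intro allI impI time_primes_ahu_polylog)
qed

end
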